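(* Let $K$ be a field, let $2<m\le n$ be integers, let $X=(x_{ij})$ be a generic $m\times n$ matrix of indeterminates and $R=K[X]$. Let $\Delta$ be a pure $(m-1)$-dimensional hypergraph on $[n]$ (i.e. all hyperedges of $\Delta$ have cardinality $m$). Then the generators of $J_\Delta$, i.e. the $m$-minors $[1\ldots m|b_1\ldots b_m]$ of $X$ with $\{b_1,\dots,b_m\}\in\Delta$, form a universal Gr\"obner basis of $J_\Delta$ if and only if $\Delta$ is a disjoint union of $m$-cliques.
   Context: $[n]=\{1,\dots,n\}$. A hypergraph on $[n]$ is a family of subsets of $[n]$ (its hyperedges). $[1\ldots m|b_1\ldots b_m]$ denotes the minor of $X$ with rows $1,\dots,m$ and columns $b_1,\dots,b_m$, and $J_\Delta$ is the ideal of $R$ generated by these minors for $\{b_1,\dots,b_m\}\in\Delta$. An $m$-clique is a hypergraph of the form $\Delta_{(m),T}=\{T'\subseteq T:|T'|=m\}$ with $T\subseteq[n]$; its vertex set is $T$. "Disjoint union of $m$-cliques" means that $\Delta$ is a union of $m$-cliques whose vertex sets are pairwise disjoint. A universal Gr\"obner basis is a set that is a Gr\"obner basis with respect to every term order on $K[X]$. *)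

theory Defs
  imports
    "HOL-Library.Poly_Mapping"
    "HOL-Library.Disjoint_Sets"
    "HOL-Algebra.Ideal"
    "Jordan_Normal_Form.Determinant"
begin

text \<open>
  A monomial in indeterminates indexed by \<open>'x\<close> is its exponent vector, and a polynomial over
  \<open>'k\<close> is a finitely supported map from monomials to coefficients; the product of
  \<^theory>\<open>HOL-Library.Poly_Mapping\<close> is then the usual product of polynomials.
\<close>

type_synonym 'x monom = "'x \<Rightarrow>\<^sub>0 nat"
type_synonym ('x, 'k) mpoly = "'x monom \<Rightarrow>\<^sub>0 'k"

definition monoms :: "'x set \<Rightarrow> 'x monom set" where
  "monoms V = {s. Poly_Mapping.keys s \<subseteq> V}"

text \<open>The polynomial ring \<open>K[V]\<close>, where \<open>K\<close> is the coefficient type and \<open>V\<close> the set of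
  indeterminates.\<close>

definition poly_ring :: "'x set \<Rightarrow> ('x, 'k::field) mpoly ring" where
  "poly_ring V =
     \<lparr>carrier = {p. Poly_Mapping.keys p \<subseteq> monoms V},
      monoid.mult = (*), one = 1, ring.zero = 0, add = (+)\<rparr>"

subsection \<open>Term orders and Groebner bases\<close>

text \<open>A term order is given as its reflexive order relation; \<open>0\<close> is the exponent vector of the
  monomial \<open>1\<close>, and addition of exponent vectors is multiplication of monomials.\<close>

definition term_order :: "'x set \<Rightarrow> 'x monom rel \<Rightarrow> bool" where
  "term_order V r \<longleftrightarrow>
     linear_order_on (monoms V) r \<and>
     (\<forall>s \<in> monoms V. (0, s) \<in> r) \<and>
     (\<forall>s \<in> monoms V. \<forall>t \<in> monoms V. \<forall>u \<in> monoms V. (s, t) \<in> r \<longrightarrow> (s + u, t + u) \<in> r)"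

text \<open>Only meaningful for nonzero \<open>p\<close>.\<close>

definition lead_monom :: "'x monom rel \<Rightarrow> ('x, 'k::field) mpoly \<Rightarrow> 'x monom" where
  "lead_monom r p = (THE t. t \<in> Poly_Mapping.keys p \<and> (\<forall>s \<in> Poly_Mapping.keys p. (s, t) \<in> r))"

definition initial_ideal ::
    "'x set \<Rightarrow> 'x monom rel \<Rightarrow> ('x, 'k::field) mpoly set \<Rightarrow> ('x, 'k) mpoly set" where
  "initial_ideal V r F =
     Idl\<^bsub>poly_ring V\<^esub> {Poly_Mapping.single (lead_monom r f) 1 |f. f \<in> F \<and> f \<noteq> 0}"

definition groebner_basis ::
    "'x set \<Rightarrow> 'x monom rel \<Rightarrow> ('x, 'k::field) mpoly set \<Rightarrow> ('x, 'k) mpoly set \<Rightarrow> bool" where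
  "groebner_basis V r G I \<longleftrightarrow>
     finite G \<and> G \<subseteq> I \<and> initial_ideal V r G = initial_ideal V r I"

definition universal_groebner_basis ::
    "'x set \<Rightarrow> ('x, 'k::field) mpoly set \<Rightarrow> ('x, 'k) mpoly set \<Rightarrow> bool" where
  "universal_groebner_basis V G I \<longleftrightarrow> (\<forall>r. term_order V r \<longrightarrow> groebner_basis V r G I)"

subsection \<open>Maximal minors of a generic matrix\<close>

text \<open>The indeterminate \<open>x\<^sub>i\<^sub>j\<close> has index \<open>(i, j)\<close>, counted from 1.\<close>

definition gen_vars :: "nat \<Rightarrow> nat \<Rightarrow> (nat \<times> nat) set" where
  "gen_vars m n = {1..m} \<times> {1..n}"

definition X_entry :: "nat \<Rightarrow> nat \<Rightarrow> (nat \<times> nat, 'k::field) mpoly" where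
  "X_entry i j = Poly_Mapping.single (Poly_Mapping.single (i, j) 1) 1"

text \<open>\<open>[1\<dots>m|b\<^sub>1\<dots>b\<^sub>m]\<close> for \<open>B = {b\<^sub>1 < \<dots> < b\<^sub>m}\<close>; matrices and lists of the library are indexed
  from 0.\<close>

definition minor :: "nat \<Rightarrow> nat set \<Rightarrow> (nat \<times> nat, 'k::field) mpoly" where
  "minor m B = det (mat m m (\<lambda>(i, j). X_entry (Suc i) (sorted_list_of_set B ! j)))"

definition minors :: "nat \<Rightarrow> nat set set \<Rightarrow> (nat \<times> nat, 'k::field) mpoly set" where
  "minors m \<Delta> = minor m ` \<Delta>"

definition J_ideal :: "nat \<Rightarrow> nat \<Rightarrow> nat set set \<Rightarrow> (nat \<times> nat, 'k::field) mpoly set" where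
  "J_ideal m n \<Delta> = Idl\<^bsub>poly_ring (gen_vars m n)\<^esub> (minors m \<Delta>)"

subsection \<open>Hypergraphs\<close>

definition pure_hypergraph :: "nat \<Rightarrow> nat \<Rightarrow> nat set set \<Rightarrow> bool" where
  "pure_hypergraph m n \<Delta> \<longleftrightarrow> (\<forall>B \<in> \<Delta>. B \<subseteq> {1..n} \<and> card B = m)"

definition clique :: "nat \<Rightarrow> 'a set \<Rightarrow> 'a set set" where
  "clique m T = {T'. T' \<subseteq> T \<and> card T' = m}"

definition disjoint_union_of_cliques :: "nat \<Rightarrow> nat \<Rightarrow> nat set set \<Rightarrow> bool" where
  "disjoint_union_of_cliques m n \<Delta> \<longleftrightarrow>
     (\<exists>\<T>. (\<forall>T \<in> \<T>. T \<subseteq> {1..n}) \<and> disjoint \<T> \<and> \<Delta> = (\<Union>T \<in> \<T>. clique m T))"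

subsection \<open>Well-definedness\<close>

text \<open>\<^const>\<open>genideal\<close> is an intersection over all ideals, which would be everything if
  \<^const>\<open>poly_ring\<close> were not a ring or did not contain the generators.\<close>

lemma monoms_add: "s \<in> monoms V \<Longrightarrow> t \<in> monoms V \<Longrightarrow> s + t \<in> monoms V"
  using Poly_Mapping.keys_add[of s t] by (auto simp: monoms_def)

lemma zero_in_monoms [simp]: "0 \<in> monoms V"
  by (simp add: monoms_def)

lemma poly_mult_closed:
  fixes p q :: "('x, 'k::field) mpoly"
  assumes "Poly_Mapping.keys p \<subseteq> monoms V" "Poly_Mapping.keys q \<subseteq> monoms V"
  shows "Poly_Mapping.keys (p * q) \<subseteq> monoms V"
proof
  fix u assume "u \<in> Poly_Mapping.keys (p * q)"
  then obtain a b where "a \<in> Poly_Mapping.keys p" "b \<in> Poly_Mapping.keys q" "u = a + b"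
    using Poly_Mapping.keys_mult[of p q] by auto
  then show "u \<in> monoms V"
    using assms monoms_add by blast
qed

lemma poly_add_closed:
  fixes p q :: "('x, 'k::field) mpoly"
  assumes "Poly_Mapping.keys p \<subseteq> monoms V" "Poly_Mapping.keys q \<subseteq> monoms V"
  shows "Poly_Mapping.keys (p + q) \<subseteq> monoms V"
  using assms keys_add[of p q] by blast

lemma cring_poly_ring: "cring (poly_ring V :: ('x, 'k::field) mpoly ring)"
proof (rule cringI)
  show "abelian_group (poly_ring V :: ('x, 'k::field) mpoly ring)"
  proof (rule abelian_groupI)
    fix x :: "('x, 'k) mpoly"
    assume "x \<in> carrier (poly_ring V)"
    then show "\<exists>y \<in> carrier (poly_ring V). y \<oplus>\<^bsub>poly_ring V\<^esub> x = \<zero>\<^bsub>poly_ring V\<^esub>"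
      by (intro bexI[of _ "- x"]) (auto simp: poly_ring_def)
  qed (auto simp: poly_ring_def add.assoc add.commute dest: poly_add_closed[THEN subsetD, rotated -1])
  show "comm_monoid (poly_ring V :: ('x, 'k::field) mpoly ring)"
    by (rule comm_monoidI)
      (auto simp: poly_ring_def mult.assoc mult.commute dest: poly_mult_closed[THEN subsetD, rotated -1])
qed (auto simp: poly_ring_def distrib_right)

lemma lead_monom_in_keys:
  fixes p :: "('x, 'k::field) mpoly"
  assumes r: "term_order V r" and p: "p \<in> carrier (poly_ring V)" "p \<noteq> 0"
  shows "lead_monom r p \<in> Poly_Mapping.keys p"
    and "\<And>s. s \<in> Poly_Mapping.keys p \<Longrightarrow> (s, lead_monom r p) \<in> r"
proof -
  have lin: "antisym r" "trans r" "refl_on (monoms V) r" "total_on (monoms V) r"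
    using r by (auto simp: term_order_def order_on_defs)
  have "finite S \<Longrightarrow> S \<noteq> {} \<Longrightarrow> S \<subseteq> monoms V \<Longrightarrow> \<exists>t \<in> S. \<forall>s \<in> S. (s, t) \<in> r" for S
  proof (induction S rule: finite_ne_induct)
    case (singleton x)
    then show ?case using lin(3) by (auto simp: refl_on_def)
  next
    case (insert x F)
    then obtain t where t: "t \<in> F" "\<forall>s \<in> F. (s, t) \<in> r" by auto
    have xt: "x \<in> monoms V" "t \<in> monoms V" "x \<noteq> t" using insert t by auto
    then consider "(x, t) \<in> r" | "(t, x) \<in> r" using lin(4) by (auto simp: total_on_def)
    then show ?case
    proof cases
      case 1
      then show ?thesis using t by auto
    next
      case 2
      have "(x, x) \<in> r" using lin(3) xt by (auto simp: refl_on_def)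
      moreover have "\<forall>s \<in> F. (s, x) \<in> r" using t(2) 2 lin(2) by (meson transD)
      ultimately show ?thesis by auto
    qed
  qed
  from this[of "Poly_Mapping.keys p"] p obtain t
    where t: "t \<in> Poly_Mapping.keys p" "\<forall>s \<in> Poly_Mapping.keys p. (s, t) \<in> r"
    by (auto simp: poly_ring_def)
  then have "lead_monom r p = t"
    unfolding lead_monom_def using lin(1) by (intro the_equality) (auto dest: antisymD)
  with t show "lead_monom r p \<in> Poly_Mapping.keys p" "\<And>s. s \<in> Poly_Mapping.keys p \<Longrightarrow> (s, lead_monom r p) \<in> r"
    by auto
qed

lemma minor_in_carrier:
  assumes "B \<subseteq> {1..n}" "card B = m"
  shows "minor m B \<in> carrier (poly_ring (gen_vars m n) :: (nat \<times> nat, 'k::field) mpoly ring)"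
proof -
  let ?V = "gen_vars m n"
  let ?C = "{p :: (nat \<times> nat, 'k) mpoly. Poly_Mapping.keys p \<subseteq> monoms ?V}"
  have sum: "sum f A \<in> ?C" if "\<And>a. a \<in> A \<Longrightarrow> f a \<in> ?C"
    for f :: "(nat \<Rightarrow> nat) \<Rightarrow> (nat \<times> nat, 'k) mpoly" and A
    using that by (induction A rule: infinite_finite_induct) (simp_all add: poly_add_closed)
  have prod: "prod f A \<in> ?C" if "\<And>a. a \<in> A \<Longrightarrow> f a \<in> ?C"
    for f :: "nat \<Rightarrow> (nat \<times> nat, 'k) mpoly" and A
    using that by (induction A rule: infinite_finite_induct) (simp_all add: poly_mult_closed)
  have sgn: "signof p * q \<in> ?C" if "q \<in> ?C" for p :: "nat \<Rightarrow> nat" and q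
    using that by (simp add: sign_def)
  have "finite B" using assms finite_subset by blast
  then have nth: "sorted_list_of_set B ! j \<in> {1..n}" if "j < m" for j
    using that assms nth_mem[of j "sorted_list_of_set B"] by auto
  have entry: "(X_entry (Suc i) (sorted_list_of_set B ! j) :: (nat \<times> nat, 'k) mpoly) \<in> ?C"
    if "i < m" "j < m" for i j
    using that nth[of j] by (simp add: X_entry_def monoms_def gen_vars_def)
  have "minor m B \<in> ?C"
    unfolding minor_def det_def dim_row_mat dim_col_mat if_P[OF refl]
  proof (intro sum sgn prod)
    fix p i assume p: "p \<in> {p. p permutes {0..<m}}" and i: "i \<in> {0..<m}"
    then have "p i < m" using permutes_in_image[of p "{0..<m}" i] by auto
    with i show "mat m m (\<lambda>(i, j). X_entry (Suc i) (sorted_list_of_set B ! j)) $$ (i, p i) \<in> ?C"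
      using entry[of i "p i"] by simp
  qed
  then show ?thesis by (simp add: poly_ring_def)
qed

end

theory Submission
  imports Defs "HOL-Library.Infinite_Set" "HOL-Library.Product_Lexorder"
begin

text \<open>
  Throughout, a minor with column set \<open>B\<close> is identified with its monomials, and these with the
  perfect matchings of the rows \<open>{1..m}\<close> and the columns \<open>B\<close>; all coefficients are \<open>\<plusminus> 1\<close>. By
  \<open>groebner_minors_iff\<close> the minors form a Groebner basis iff every nonzero element of the ideal has
  a leading monomial containing the leading matching of some minor.

  Cliques give Groebner bases (\<open>clique_minors_groebner_basis\<close>). Represent the term order on the
  finitely many monomials in question by real weights \<open>\<omega>\<close> of the cells (\<open>term_order_weight\<close>) and
  let \<open>w\<close> be the leading monomial of an element \<open>f\<close> of the ideal. By linear programming duality a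
  set of cells is a heaviest matching iff suitable shifts \<open>v\<close> of the rows make each of its cells
  maximal in its column. A tropical Farkas lemma (\<open>tropical_alternative\<close>) says that, for each
  clique, either \<open>w\<close> contains such a heaviest matching, or some \<open>v\<close>, possibly with entries
  \<open>-\<infinity>\<close>, makes no cell of \<open>w\<close> the only maximum of its column. In the second case the cells of \<open>w\<close>
  can be filled with elements of exact degree \<open>\<omega>\<close>, and the other cells with elements of at most
  this degree, such that all columns of the clique are orthogonal to one vector of degree \<open>v\<close>. If
  this happens in every clique, then all minors vanish at this matrix, yet \<open>f\<close> does not, since its
  heaviest term survives (\<open>no_strictly_heaviest_monomial\<close>).

  Conversely, let the minors be a universal Groebner basis. If two edges differ in one vertex and
  some \<open>m\<close>-subset of their union is missing, then a part of the Laplace relation among the minors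
  of these \<open>m + 1\<close> columns lies in the ideal and has, for a suitable weight, a leading monomial that
  contains no leading matching (\<open>adjacent_edges\<close>). If two intersecting edges differ in at least two
  vertices, a suitable weight gives their leading monomials a common factor and makes the
  S-polynomial reducible only by a third edge that lies in their union and is closer to one of
  them (\<open>third_edge\<close>). Combining the two facts, the union of two intersecting edges is a clique
  (\<open>union_is_clique\<close>), so the maximal cliques are disjoint.
\<close>

section \<open>Linear functionals positive on finitely many vectors\<close>

lemma real_between_finite:
  fixes L U :: "real set"
  assumes "finite L" "finite U" and lu: "\<And>l u. l \<in> L \<Longrightarrow> u \<in> U \<Longrightarrow> l < u"
  obtains c where "\<forall>l \<in> L. l < c" "\<forall>u \<in> U. c < u"
proof (cases "L = {} \<or> U = {}")
  case True
  then show ?thesis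
  proof
    assume "L = {}"
    moreover obtain c where "\<forall>u \<in> uminus ` U. u < c"
      using assms(2) ex_gt_or_lt infinite_growing[of "uminus ` U"] finite_imageI[of U uminus]
      by (metis Max_less_iff empty_iff gt_ex)
    ultimately show ?thesis by (intro that[of "- c"]) force+
  next
    assume "U = {}"
    moreover obtain c where "\<forall>u \<in> L. u < c"
      using assms(1) by (metis Max_less_iff empty_iff gt_ex)
    ultimately show ?thesis by (intro that[of c]) auto
  qed
next
  case False
  then have "Max L < Min U" using assms by simp
  then obtain c where "Max L < c" "c < Min U" using dense by blast
  with False assms(1,2) show ?thesis by (intro that[of c]) auto
qed

text \<open>
  Gordan's alternative, proved by Fourier-Motzkin elimination of one coordinate at a time: a
  functional positive on \<open>S\<close> exists as soon as \<open>S\<close> lies in an additively closed set \<open>C\<close> that misses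
  \<open>0\<close>. Closure of \<open>C\<close> is what survives the elimination step, which replaces \<open>S\<close> by positive
  combinations of its elements.
\<close>

lemma positive_weight_exists:
  fixes C :: "('x \<Rightarrow> int) set" and S :: "('x \<Rightarrow> int) set"
  assumes "finite V" "finite S" "S \<subseteq> C"
    and add: "\<And>d e. d \<in> C \<Longrightarrow> e \<in> C \<Longrightarrow> (\<lambda>x. d x + e x) \<in> C"
    and zero: "(\<lambda>x. 0) \<notin> C"
    and supp: "\<And>d x. d \<in> S \<Longrightarrow> x \<notin> V \<Longrightarrow> d x = 0"
  shows "\<exists>\<omega> :: 'x \<Rightarrow> real. \<forall>d \<in> S. (\<Sum>x\<in>V. \<omega> x * d x) > 0"
  using assms(1,2,3) supp
proof (induction V arbitrary: S rule: finite_induct)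
  case empty
  then have "d \<in> S \<Longrightarrow> d = (\<lambda>x. 0)" for d by auto
  with empty zero have "S = {}" by blast
  then show ?case by simp
next
  case (insert y V)
  have mult: "(\<lambda>x. int (Suc k) * d x) \<in> C" if "d \<in> C" for k d
  proof (induction k)
    case (Suc k)
    have "(\<lambda>x. int (Suc (Suc k)) * d x) = (\<lambda>x. int (Suc k) * d x + d x)"
      by (auto simp: algebra_simps)
    then show ?case using add[OF Suc that] by simp
  qed (use that in simp)
  have comb: "(\<lambda>x. - n y * p x + p y * n x) \<in> C" if "p \<in> C" "n \<in> C" "p y > 0" "n y < 0" for p n
  proof -
    have "- n y = int (Suc (nat (- n y) - 1))" "p y = int (Suc (nat (p y) - 1))" using that by auto
    then show ?thesis using add[OF mult[OF that(1)] mult[OF that(2)]] by metis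
  qed
  define P N Z where "P = {d \<in> S. d y > 0}" and "N = {d \<in> S. d y < 0}" and "Z = {d \<in> S. d y = 0}"
  \<comment> \<open>Fourier-Motzkin: each pair with opposite signs at \<open>y\<close> is combined so that \<open>y\<close> cancels.\<close>
  define S' where "S' = Z \<union> (\<lambda>(p, n) x. - n y * p x + p y * n x) ` (P \<times> N)"
  have fin: "finite P" "finite N" "finite Z" using insert.prems(1) by (auto simp: P_def N_def Z_def)
  have finS': "finite S'" using fin by (simp add: S'_def)
  have subS': "S' \<subseteq> C" using insert.prems(2) comb by (auto simp: S'_def P_def N_def Z_def)
  have suppS': "d x = 0" if "d \<in> S'" "x \<notin> V" for d x
  proof (cases "x = y")
    case True
    then show ?thesis using that by (auto simp: S'_def Z_def)
  next
    case False
    then have "\<forall>e \<in> S. e x = 0" using insert.prems(3) \<open>x \<notin> V\<close> by simp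
    then have "a y * b x = b y * a x" if "a \<in> S" "b \<in> S" for a b
      using bspec[OF \<open>\<forall>e \<in> S. e x = 0\<close> that(1)] bspec[OF \<open>\<forall>e \<in> S. e x = 0\<close> that(2)] by simp
    with \<open>\<forall>e \<in> S. e x = 0\<close> show ?thesis using that(1) by (auto simp: S'_def P_def N_def Z_def)
  qed
  have "\<exists>\<omega> :: 'x \<Rightarrow> real. \<forall>d \<in> S'. (\<Sum>x\<in>V. \<omega> x * d x) > 0"
    by (rule insert.IH) (use finS' subS' suppS' in auto)
  then obtain \<omega> :: "'x \<Rightarrow> real" where \<omega>: "\<And>d. d \<in> S' \<Longrightarrow> (\<Sum>x\<in>V. \<omega> x * d x) > 0"
    by blast
  define F where "F d = (\<Sum>x\<in>V. \<omega> x * of_int (d x))" for d :: "'x \<Rightarrow> int"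
  have pair: "0 < - real_of_int (n y) * F p + real_of_int (p y) * F n" if "p \<in> P" "n \<in> N" for p n
  proof -
    have "0 < (\<Sum>x\<in>V. \<omega> x * of_int (- n y * p x + p y * n x))"
      using \<omega>[of "\<lambda>x. - n y * p x + p y * n x"] that by (force simp: S'_def)
    also have "\<dots> = - real_of_int (n y) * F p + real_of_int (p y) * F n"
      by (simp add: F_def sum_distrib_left sum.distrib[symmetric] algebra_simps)
    finally show ?thesis .
  qed
  have "l < u" if lu: "l \<in> (\<lambda>p. - F p / p y) ` P" "u \<in> (\<lambda>n. F n / - n y) ` N" for l u
  proof -
    obtain p n where pn: "p \<in> P" "n \<in> N" "l = - F p / p y" "u = F n / - n y" using lu by auto
    then have "real_of_int (p y) > 0" "- real_of_int (n y) > 0" by (auto simp: P_def N_def)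
    then show ?thesis using pair[OF pn(1,2)] unfolding pn(3,4)
      by (simp add: field_simps)
  qed
  then obtain c where "\<forall>l \<in> (\<lambda>p. - F p / p y) ` P. l < c" "\<forall>u \<in> (\<lambda>n. F n / - n y) ` N. c < u"
    by (rule real_between_finite[rotated 2]) (use fin in auto)
  then have c: "\<And>p. p \<in> P \<Longrightarrow> - F p / p y < c" "\<And>n. n \<in> N \<Longrightarrow> c < F n / - n y" by auto
  have "(\<Sum>x\<in>insert y V. (\<omega>(y := c)) x * d x) > 0" if d: "d \<in> S" for d
  proof -
    have eq: "(\<Sum>x\<in>insert y V. (\<omega>(y := c)) x * d x) = c * d y + F d"
      using insert.hyps by (auto simp: F_def intro!: sum.cong)
    consider "d \<in> P" | "d \<in> N" | "d \<in> Z" using d by (force simp: P_def N_def Z_def)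
    then show ?thesis
    proof cases
      case 1
      then show ?thesis unfolding eq using c(1)[of d] by (simp add: P_def field_simps)
    next
      case 2
      then have "real_of_int (d y) < 0" by (simp add: N_def)
      then show ?thesis unfolding eq using c(2)[OF 2] by (simp add: field_simps)
    next
      case 3
      then show ?thesis unfolding eq using \<omega>[of d] by (simp add: Z_def F_def S'_def)
    qed
  qed
  then show ?case by blast
qed

section \<open>A tropical alternative\<close>

text \<open>
  A tropical Farkas lemma. Read \<open>v + \<omega>\<close> as a matrix whose rows have been shifted by \<open>v\<close>. Either
  some shift gives every row \<open>i\<close> a column in which a \<open>W\<close>-entry of row \<open>i\<close> is the strict maximum, or
  there is a shift, with the rows outside \<open>I\<close> shifted to \<open>-\<infinity>\<close>, under which no \<open>W\<close>-entry is the strict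
  maximum of its column.

  For fixed \<open>x\<close>, \<open>G x i\<close> below is the largest value not above \<open>x i\<close> at which row \<open>i\<close> has no strict
  maximum in a \<open>W\<close>-column. The map \<open>G\<close> is monotone and commutes with adding constants. Iterate it
  from \<open>0\<close>. If some coordinates stay bounded, their limits form the second alternative. If all of
  them tend to \<open>-\<infinity>\<close>, then \<open>g n < 0\<close> for some \<open>n\<close>, and the minimum of the first \<open>n\<close> iterates, each
  raised by its index times a small \<open>e\<close>, is pushed down strictly by \<open>G\<close> in every coordinate; this
  is the first alternative.
\<close>

lemma tropical_alternative:
  fixes \<omega> :: "'r \<Rightarrow> 'c \<Rightarrow> real" and W :: "'r \<Rightarrow> 'c \<Rightarrow> bool"
  assumes R: "finite R" "R \<noteq> {}" "\<And>i. i \<in> R \<Longrightarrow> R - {i} \<noteq> {}" and T: "finite T"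
  obtains
    (matching) v where "\<forall>i \<in> R. \<exists>j \<in> T. W i j \<and> (\<forall>k \<in> R - {i}. v k + \<omega> k j < v i + \<omega> i j)"
  | (kernel) I v where "I \<subseteq> R" "I \<noteq> {}"
      "\<forall>j \<in> T. \<forall>i \<in> I. W i j \<longrightarrow> (\<exists>k \<in> I - {i}. v i + \<omega> i j \<le> v k + \<omega> k j)"
proof -
  define M where "M x i j = Max ((\<lambda>k. x k + \<omega> k j - \<omega> i j) ` (R - {i}))" for x :: "'r \<Rightarrow> real" and i j
  define G where "G x i = Min (insert (x i) (M x i ` {j \<in> T. W i j}))" for x :: "'r \<Rightarrow> real" and i
  have G_le: "G x i \<le> x i" for x i using T by (simp add: G_def)
  have G_le_M: "G x i \<le> M x i j" if "j \<in> T" "W i j" for x i j using T that by (simp add: G_def)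
  have M_mono: "M x i j \<le> M y i j" if "\<And>k. k \<in> R \<Longrightarrow> x k \<le> y k" "i \<in> R" for x y i j
    unfolding M_def
  proof (rule Max.boundedI)
    fix a assume "a \<in> (\<lambda>k. x k + \<omega> k j - \<omega> i j) ` (R - {i})"
    then obtain k where k: "k \<in> R - {i}" "a = x k + \<omega> k j - \<omega> i j" by auto
    then have "a \<le> y k + \<omega> k j - \<omega> i j" using that by simp
    also have "\<dots> \<le> Max ((\<lambda>k. y k + \<omega> k j - \<omega> i j) ` (R - {i}))" using k R by (intro Max_ge) auto
    finally show "a \<le> Max ((\<lambda>k. y k + \<omega> k j - \<omega> i j) ` (R - {i}))" .
  qed (use R that in auto)
  have G_mono: "G x i \<le> G y i" if xy: "\<And>k. k \<in> R \<Longrightarrow> x k \<le> y k" "i \<in> R" for x y i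
  proof -
    have "G x i \<le> a" if "a \<in> insert (y i) (M y i ` {j \<in> T. W i j})" for a
      using that G_le[of x i] xy G_le_M M_mono[OF xy] by (force intro: order_trans)
    then show ?thesis unfolding G_def[of y] using T by simp
  qed
  have M_shift: "M (\<lambda>k. x k + c) i j = M x i j + c" if "i \<in> R" for x c i j
    unfolding M_def using R that
    by (subst Max_add_commute[symmetric]) (auto simp: algebra_simps)
  have G_shift: "G (\<lambda>k. x k + c) i = G x i + c" if "i \<in> R" for x c i
  proof -
    have "insert (x i + c) (M (\<lambda>k. x k + c) i ` {j \<in> T. W i j}) =
        (\<lambda>a. a + c) ` insert (x i) (M x i ` {j \<in> T. W i j})"
      using M_shift[OF that] by (auto simp: image_image)
    then have "G (\<lambda>k. x k + c) i = Min ((\<lambda>a. a + c) ` insert (x i) (M x i ` {j \<in> T. W i j}))"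
      by (simp add: G_def)
    also have "\<dots> = G x i + c"
      unfolding G_def using T Min_add_commute[of "insert (x i) (M x i ` {j \<in> T. W i j})" "\<lambda>a. a" c]
      by simp
    finally show ?thesis .
  qed
  define g where "g l = (G ^^ l) (\<lambda>_. 0)" for l
  have g0: "g 0 = (\<lambda>_. 0)" and gSuc: "g (Suc l) = G (g l)" for l by (simp_all add: g_def)
  have dec: "decseq (\<lambda>l. g l i)" for i unfolding decseq_Suc_iff gSuc using G_le by blast
  define I where "I = {i \<in> R. \<exists>b. \<forall>l. b \<le> g l i}"
  show thesis
  proof (cases "I = {}")
    case True
    then have "\<forall>i \<in> R. \<exists>l. g l i < 0" by (force simp: I_def not_le)
    then obtain f where f: "\<And>i. i \<in> R \<Longrightarrow> g (f i) i < 0" by metis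
    define n where "n = Suc (Max (f ` R))"
    have neg: "g n i < 0" if "i \<in> R" for i
    proof -
      have "f i \<le> n" using R that by (simp add: n_def le_SucI)
      then have "g n i \<le> g (f i) i" using dec[of i] by (simp add: decseq_def)
      then show ?thesis using f[OF that] by simp
    qed
    \<comment> \<open>The gain per step: after \<open>n\<close> steps every coordinate has dropped by at least \<open>n * e\<close>.\<close>
    define e where "e = - Max ((g n) ` R) / n"
    have "Max ((g n) ` R) < 0" using R neg by simp
    then have e: "e > 0" by (simp add: e_def n_def divide_neg_pos)
    have ge: "g n i + n * e \<le> 0" if "i \<in> R" for i
    proof -
      have "g n i \<le> Max ((g n) ` R)" using R that by simp
      then show ?thesis by (simp add: e_def n_def)
    qed
    define v where "v i = Min ((\<lambda>l. g l i + l * e) ` {..<n})" for i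
    have n: "n > 0" by (simp add: n_def)
    have Gv: "G v i \<le> v i - e" if i: "i \<in> R" for i
    proof -
      have step: "G v i \<le> g (Suc l) i + l * e" if "l < n" for l
      proof -
        have "G v i \<le> G (\<lambda>k. g l k + l * e) i"
          using that i by (intro G_mono) (auto simp: v_def)
        then show ?thesis using G_shift[OF i] by (simp add: gSuc)
      qed
      have "G v i + e \<le> g l i + l * e" if "l < n" for l
      proof (cases l)
        case 0
        have "G v i + e \<le> g n i + n * e" using step[of "n - 1"] n
          by (cases n) (auto simp: algebra_simps)
        then show ?thesis using ge[OF i] 0 by (simp add: g0)
      next
        case (Suc l')
        then show ?thesis using step[of l'] that by (simp add: algebra_simps)
      qed
      then have "G v i + e \<le> v i" unfolding v_def using n by (intro Min.boundedI) auto
      then show ?thesis by simp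
    qed
    have "\<exists>j \<in> T. W i j \<and> (\<forall>k \<in> R - {i}. v k + \<omega> k j < v i + \<omega> i j)" if i: "i \<in> R" for i
    proof -
      have "G v i \<in> insert (v i) (M v i ` {j \<in> T. W i j})"
        unfolding G_def using T by (intro Min_in) auto
      then obtain j where j: "j \<in> T" "W i j" "G v i = M v i j" using Gv[OF i] e by auto
      then have "M v i j < v i" using Gv[OF i] e by simp
      then have "\<forall>k \<in> R - {i}. v k + \<omega> k j - \<omega> i j < v i"
        unfolding M_def using R i by (subst (asm) Max_less_iff) auto
      then show ?thesis using j by (intro bexI[of _ j]) force+
    qed
    then show thesis by (intro matching[of v]) blast
  next
    case False
    define v where "v i = lim (\<lambda>l. g l i)" for i
    have lim: "(\<lambda>l. g l i) \<longlonglongrightarrow> v i" if "i \<in> I" for i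
    proof -
      obtain b where b: "\<forall>l. b \<le> g l i" using \<open>i \<in> I\<close> unfolding I_def by blast
      obtain L where "(\<lambda>l. g l i) \<longlonglongrightarrow> L" using decseq_convergent[OF dec[of i] b] by blast
      then have "convergent (\<lambda>l. g l i)" by (rule convergentI)
      then show ?thesis by (simp add: v_def convergent_LIMSEQ_iff)
    qed
    have "\<exists>k \<in> I - {i}. v i + \<omega> i j \<le> v k + \<omega> k j" if j: "j \<in> T" "i \<in> I" "W i j" for i j
    proof -
      have i: "i \<in> R" using j by (auto simp: I_def)
      have "\<exists>k \<in> R - {i}. g (Suc l) i \<le> g l k + \<omega> k j - \<omega> i j" for l
      proof -
        have "M (g l) i j \<in> (\<lambda>k. g l k + \<omega> k j - \<omega> i j) ` (R - {i})"
          unfolding M_def using R i by (intro Max_in) auto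
        then show ?thesis using G_le_M[OF j(1,3), of "g l"] by (auto simp: gSuc)
      qed
      \<comment> \<open>The row that attains the maximum varies with \<open>l\<close>; some row \<open>k\<close> occurs infinitely often, and the
        bound from below on row \<open>i\<close> passes to it.\<close>
      then obtain \<kappa> where \<kappa>: "\<And>l. \<kappa> l \<in> R - {i}" "\<And>l. g (Suc l) i \<le> g l (\<kappa> l) + \<omega> (\<kappa> l) j - \<omega> i j"
        by metis
      have "finite (range \<kappa>)" using \<kappa>(1) R(1) by (meson finite_Diff finite_subset image_subsetI)
      then obtain k where k: "k \<in> range \<kappa>" "infinite (\<kappa> -` {k})"
        using inf_img_fin_domE'[of \<kappa> UNIV] by (auto)
      then have often: "\<exists>l \<ge> l0. g (Suc l) i \<le> g l k + \<omega> k j - \<omega> i j" for l0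
      proof -
        obtain l where "l \<ge> l0" "\<kappa> l = k"
          using k(2) unfolding infinite_nat_iff_unbounded_le by blast
        then show ?thesis using \<kappa>(2)[of l] by blast
      qed
      have lower: "v i \<le> g l i" for l by (rule decseq_ge[OF dec lim[OF j(2)]])
      have bound: "v i + \<omega> i j - \<omega> k j \<le> g l k" for l
      proof -
        obtain l' where "l' \<ge> l" "g (Suc l') i \<le> g l' k + \<omega> k j - \<omega> i j" using often by blast
        moreover have "g l' k \<le> g l k" using dec[of k] calculation(1) by (simp add: decseq_def)
        ultimately show ?thesis using lower[of "Suc l'"] by linarith
      qed
      have kR: "k \<in> R - {i}" using k(1) \<kappa>(1) by auto
      then have kI: "k \<in> I" using bound by (auto simp: I_def)
      have "v i + \<omega> i j - \<omega> k j \<le> v k" using bound by (intro LIMSEQ_le_const[OF lim[OF kI]]) blast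
      then show ?thesis using kI kR by (intro bexI[of _ k]) auto
    qed
    then show thesis using False by (intro kernel[of I v]) (auto simp: I_def)
  qed
qed

section \<open>Monomials\<close>

abbreviation msingle :: "'x monom \<Rightarrow> ('x, 'k::field) mpoly" where
  "msingle s \<equiv> Poly_Mapping.single s 1"

definition sqfree_monom :: "'x set \<Rightarrow> 'x monom" where
  "sqfree_monom E = (\<Sum>x\<in>E. Poly_Mapping.single x 1)"

lemma lookup_sqfree_monom: "finite E \<Longrightarrow> Poly_Mapping.lookup (sqfree_monom E) x = (if x \<in> E then 1 else 0)"
  by (simp add: sqfree_monom_def lookup_sum lookup_single when_def if_distrib sum.delta cong: if_cong)

lemma keys_sqfree_monom [simp]: "finite E \<Longrightarrow> Poly_Mapping.keys (sqfree_monom E) = E"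
  by (auto simp: in_keys_iff lookup_sqfree_monom split: if_splits)

lemma sqfree_monom_inject: "finite E \<Longrightarrow> finite F \<Longrightarrow> sqfree_monom E = sqfree_monom F \<longleftrightarrow> E = F"
  by (metis keys_sqfree_monom)

lemma sqfree_monom_union: "finite E \<Longrightarrow> finite F \<Longrightarrow> E \<inter> F = {} \<Longrightarrow> sqfree_monom (E \<union> F) = sqfree_monom E + sqfree_monom F"
  by (simp add: sqfree_monom_def sum.union_disjoint)

definition monom_dvd :: "'x monom \<Rightarrow> 'x monom \<Rightarrow> bool" where
  "monom_dvd s t \<longleftrightarrow> (\<exists>u. t = s + u)"

lemma monom_dvd_iff_lookup: "monom_dvd s t \<longleftrightarrow> (\<forall>x. Poly_Mapping.lookup s x \<le> Poly_Mapping.lookup t x)"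
proof
  assume R: "\<forall>x. Poly_Mapping.lookup s x \<le> Poly_Mapping.lookup t x"
  have "t = s + (t - s)" by (rule poly_mapping_eqI) (use R in \<open>simp add: lookup_add lookup_minus\<close>)
  then show "monom_dvd s t" unfolding monom_dvd_def by blast
qed (auto simp: monom_dvd_def lookup_add)

lemma sqfree_monom_dvd_iff: "finite E \<Longrightarrow> monom_dvd (sqfree_monom E) t \<longleftrightarrow> E \<subseteq> Poly_Mapping.keys t"
  by (auto simp: monom_dvd_iff_lookup lookup_sqfree_monom in_keys_iff split: if_splits)

lemma lookup_single_times:
  fixes p :: "('a::{cancel_comm_monoid_add}) \<Rightarrow>\<^sub>0 ('b::comm_semiring_1)"
  shows "Poly_Mapping.lookup (Poly_Mapping.single s c * p) (s + t) = c * Poly_Mapping.lookup p t"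
proof -
  have "Poly_Mapping.lookup (Poly_Mapping.single s c * p) (s + t) =
      (\<Sum>a. (Poly_Mapping.lookup (Poly_Mapping.single s c) a * (\<Sum>q. Poly_Mapping.lookup p q when s + t = a + q)))"
    by (rule lookup_mult)
  also have "\<dots> = (\<Sum>a. (c * (\<Sum>q. Poly_Mapping.lookup p q when s + t = a + q) when a = s))"
    by (rule arg_cong[where f=Sum_any], rule ext) (simp add: lookup_single when_def)
  also have "\<dots> = c * (\<Sum>q. Poly_Mapping.lookup p q when s + t = s + q)" by simp
  also have "(\<Sum>q. Poly_Mapping.lookup p q when s + t = s + q) = (\<Sum>q. Poly_Mapping.lookup p q when q = t)"
    by (rule arg_cong[where f=Sum_any], rule ext) (auto simp: when_def)
  finally show ?thesis by simp
qed

lemma keys_single_times: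
  fixes p :: "('x, 'k::field) mpoly"
  shows "c \<noteq> 0 \<Longrightarrow> Poly_Mapping.keys (Poly_Mapping.single s c * p) = (\<lambda>t. s + t) ` Poly_Mapping.keys p"
  using keys_mult[of "Poly_Mapping.single s c" p]
  by (auto simp: lookup_single_times in_keys_iff split: if_splits)

section \<open>Expansion of the minors\<close>

text \<open>
  Sets of cells of the matrix, one in each row of \<open>R\<close> and each column of \<open>B\<close>. They index the terms
  of a determinant, which avoids the signs and the sorting of the columns.
\<close>

definition matching :: "'r set \<Rightarrow> 'c set \<Rightarrow> ('r \<times> 'c) set \<Rightarrow> bool" where
  "matching R B E \<longleftrightarrow> bij_betw fst E R \<and> bij_betw snd E B"

lemma prod_X_entry:
  "finite A \<Longrightarrow> (\<Prod>i\<in>A. X_entry (f i) (g i)) = (msingle (\<Sum>i\<in>A. Poly_Mapping.single (f i, g i) 1) :: (nat \<times> nat, 'k::field) mpoly)"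
  by (induction A rule: finite_induct) (simp_all add: X_entry_def mult_single)

text \<open>
  The Leibniz formula reindexed: permutations \<open>p\<close> correspond bijectively to perfect matchings
  \<open>E p\<close> of rows and columns, so distinct terms have distinct monomials and nothing cancels.
\<close>

lemma minor_expansion:
  assumes B: "finite B" "card B = m"
  defines "L \<equiv> sorted_list_of_set B"
  defines "P \<equiv> {p. p permutes {0..<m}}"
  defines "E \<equiv> \<lambda>p. (\<lambda>i. (Suc i, L ! p i)) ` {0..<m}"
  shows "minor m B = (\<Sum>p\<in>P. Poly_Mapping.single (sqfree_monom (E p)) (signof p :: 'k::field))"
    and "inj_on E P" and "E ` P = {E. matching {1..m} B E}"
proof -
  have L: "distinct L" "length L = m" "set L = B" using B by (simp_all add: L_def)
  have Lb: "bij_betw ((!) L) {0..<m} B" using L bij_betw_nth[OF L(1), of "{0..<m}" B] by (auto simp: atLeast0LessThan)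
  have injE: "inj_on (\<lambda>i. (Suc i, L ! p i)) A" for p A by (auto simp: inj_on_def)
  have "signof p * (\<Prod>i=0..<m. mat m m (\<lambda>(i, j). X_entry (Suc i) (L ! j)) $$ (i, p i)) =
      Poly_Mapping.single (sqfree_monom (E p)) (signof p :: 'k)" if "p \<in> P" for p
  proof -
    have "p i < m" if "i < m" for i using \<open>p \<in> P\<close> permutes_in_image[of p "{0..<m}" i] that by (auto simp: P_def)
    then have "(\<Prod>i=0..<m. mat m m (\<lambda>(i, j). X_entry (Suc i) (L ! j)) $$ (i, p i)) =
        (\<Prod>i=0..<m. X_entry (Suc i) (L ! p i) :: (nat \<times> nat, 'k) mpoly)"
      by (intro prod.cong) auto
    also have "\<dots> = msingle (sqfree_monom (E p))"
      unfolding prod_X_entry[OF finite_atLeastLessThan] sqfree_monom_def E_def by (simp add: sum.reindex[OF injE])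
    finally have "(\<Prod>i=0..<m. mat m m (\<lambda>(i, j). X_entry (Suc i) (L ! j)) $$ (i, p i)) =
        (msingle (sqfree_monom (E p)) :: (nat \<times> nat, 'k) mpoly)" .
    then show ?thesis by (simp add: sign_def single_uminus)
  qed
  then show "minor m B = (\<Sum>p\<in>P. Poly_Mapping.single (sqfree_monom (E p)) (signof p :: 'k::field))"
    unfolding minor_def det_def by (simp add: P_def L_def)
  show "inj_on E P"
  proof (rule inj_onI)
    fix p q assume pq: "p \<in> P" "q \<in> P" "E p = E q"
    show "p = q"
    proof
      fix i
      show "p i = q i"
      proof (cases "i < m")
        case True
        then have "(Suc i, L ! p i) \<in> E q" using pq(3)[symmetric] by (simp add: E_def)
        then have "L ! p i = L ! q i" by (auto simp: E_def)
        moreover have "p i < m" "q i < m"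
          using pq permutes_in_image[of p "{0..<m}" i] permutes_in_image[of q "{0..<m}" i] True by (auto simp: P_def)
        ultimately show ?thesis using L by (simp add: nth_eq_iff_index_eq)
      next
        case False
        then show ?thesis using pq by (auto simp: P_def permutes_def)
      qed
    qed
  qed
  show "E ` P = {E. matching {1..m} B E}"
  proof (intro equalityI subsetI)
    fix F assume "F \<in> E ` P"
    then obtain p where p: "p permutes {0..<m}" "F = E p" by (auto simp: P_def)
    have "bij_betw fst F {1..m}" unfolding p(2) E_def bij_betw_def
      by (auto simp: inj_on_def image_image image_Suc_atLeastLessThan)
    moreover have "bij_betw (\<lambda>i. L ! p i) {0..<m} B"
      using bij_betw_trans[OF permutes_imp_bij[OF p(1)] Lb] by (simp add: o_def)
    then have "bij_betw snd F B" unfolding p(2) E_def bij_betw_def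
      by (auto simp: inj_on_def image_image)
    ultimately show "F \<in> {E. matching {1..m} B E}" by (simp add: matching_def)
  next
    fix F assume "F \<in> {E. matching {1..m} B E}"
    then have F: "bij_betw fst F {1..m}" "bij_betw snd F B" by (auto simp: matching_def)
    define p where "p i = (if i < m then the_inv_into {0..<m} ((!) L) (snd (the_inv_into F fst (Suc i))) else i)" for i
    have Suc: "bij_betw Suc {0..<m} {1..m}" by (auto simp: bij_betw_def image_Suc_atLeastLessThan)
    have "bij_betw (the_inv_into {0..<m} ((!) L) \<circ> (snd \<circ> (the_inv_into F fst \<circ> Suc))) {0..<m} {0..<m}"
      by (intro bij_betw_trans[OF bij_betw_trans[OF bij_betw_trans[OF Suc bij_betw_the_inv_into[OF F(1)]] F(2)]]
          bij_betw_the_inv_into[OF Lb])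
    moreover have "p i = (the_inv_into {0..<m} ((!) L) \<circ> (snd \<circ> (the_inv_into F fst \<circ> Suc))) i" if "i \<in> {0..<m}" for i
      using that by (simp add: p_def)
    ultimately have "bij_betw p {0..<m} {0..<m}" using bij_betw_cong by metis
    then have "p permutes {0..<m}" by (intro bij_imp_permutes) (auto simp: p_def)
    moreover have "F = E p"
    proof -
      have "(Suc i, L ! p i) = the_inv_into F fst (Suc i)" if i: "i < m" for i
      proof -
        have m: "the_inv_into F fst (Suc i) \<in> F"
          using i F(1) by (metis Suc_leI atLeastAtMost_iff bij_betwE bij_betw_the_inv_into le_add1 plus_1_eq_Suc)
        have "fst (the_inv_into F fst (Suc i)) = Suc i"
          using f_the_inv_into_f_bij_betw[OF F(1)] i by simp
        moreover have "L ! p i = snd (the_inv_into F fst (Suc i))"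
          using f_the_inv_into_f_bij_betw[OF Lb, of "snd (the_inv_into F fst (Suc i))"] F(2) m i
          by (auto simp: p_def bij_betwE)
        ultimately show ?thesis by (metis prod.collapse)
      qed
      then have "E p = (the_inv_into F fst \<circ> Suc) ` {0..<m}" by (simp add: E_def)
      also have "\<dots> = F"
        using bij_betw_trans[OF Suc bij_betw_the_inv_into[OF F(1)]] by (auto simp: bij_betw_def)
      finally show ?thesis by simp
    qed
    ultimately show "F \<in> E ` P" by (auto simp: P_def)
  qed
qed

lemma matching_finite: "finite B \<Longrightarrow> matching R B E \<Longrightarrow> finite E"
  using bij_betw_finite[of snd E B] by (simp add: matching_def)

lemma keys_minor:
  assumes B: "finite B" "card B = m"
  shows "Poly_Mapping.keys (minor m B :: (nat \<times> nat, 'k::field) mpoly) = sqfree_monom ` {E. matching {1..m} B E}"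
    and "matching {1..m} B E \<Longrightarrow>
      Poly_Mapping.lookup (minor m B :: (nat \<times> nat, 'k) mpoly) (sqfree_monom E) = 1 \<or>
      Poly_Mapping.lookup (minor m B :: (nat \<times> nat, 'k) mpoly) (sqfree_monom E) = - 1"
proof -
  define L where "L = sorted_list_of_set B"
  define P where "P = {p. p permutes {0..<m}}"
  define E where "E = (\<lambda>p. (\<lambda>i. (Suc i, L ! p i)) ` {0..<m})"
  note ex = minor_expansion[OF B, folded L_def, folded P_def E_def]
  have finE: "finite (E p)" for p by (simp add: E_def)
  have finP: "finite P" by (simp add: P_def finite_permutations)
  have inj: "inj_on (\<lambda>p. sqfree_monom (E p)) P"
    using ex(2) by (auto simp: inj_on_def sqfree_monom_inject[OF finE finE])
  have coeff: "Poly_Mapping.lookup (minor m B :: (nat \<times> nat, 'k) mpoly) (sqfree_monom (E p)) = signof p" if p: "p \<in> P" for p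
  proof -
    have "Poly_Mapping.lookup (minor m B :: (nat \<times> nat, 'k) mpoly) (sqfree_monom (E p)) =
        (\<Sum>q\<in>P. (signof q when sqfree_monom (E q) = sqfree_monom (E p)))"
      unfolding ex(1) lookup_sum lookup_single by (simp add: E_def)
    also have "\<dots> = (\<Sum>q\<in>P. if q = p then signof q else 0)"
      using inj p by (intro sum.cong) (auto simp: when_def inj_on_def)
    also have "\<dots> = signof p" using finP p by simp
    finally show ?thesis .
  qed
  have "Poly_Mapping.keys (minor m B :: (nat \<times> nat, 'k) mpoly) = (\<lambda>p. sqfree_monom (E p)) ` P"
  proof
    show "Poly_Mapping.keys (minor m B :: (nat \<times> nat, 'k) mpoly) \<subseteq> (\<lambda>p. sqfree_monom (E p)) ` P"
    proof
      fix t assume "t \<in> Poly_Mapping.keys (minor m B :: (nat \<times> nat, 'k) mpoly)"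
      then have "(\<Sum>q\<in>P. (signof q when sqfree_monom (E q) = t)) \<noteq> (0 :: 'k)"
        unfolding in_keys_iff ex(1) lookup_sum lookup_single by (simp add: E_def)
      then obtain q where "q \<in> P" "(signof q when sqfree_monom (E q) = t) \<noteq> (0 :: 'k)" by (meson sum.neutral)
      then show "t \<in> (\<lambda>p. sqfree_monom (E p)) ` P" by (auto simp: when_def split: if_splits)
    qed
  qed (auto simp: in_keys_iff coeff sign_def)
  then show "Poly_Mapping.keys (minor m B :: (nat \<times> nat, 'k) mpoly) = sqfree_monom ` {E. matching {1..m} B E}"
    unfolding ex(3)[symmetric] by (simp add: image_image)
  fix F assume "matching {1..m} B F"
  then obtain p where "p \<in> P" "F = E p" using ex(3) by blast
  then show "Poly_Mapping.lookup (minor m B :: (nat \<times> nat, 'k) mpoly) (sqfree_monom F) = 1 \<or>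
      Poly_Mapping.lookup (minor m B :: (nat \<times> nat, 'k) mpoly) (sqfree_monom F) = - 1"
    using coeff by (simp add: sign_def)
qed

lemma minor_nonzero:
  assumes "finite B" "card B = m"
  shows "(minor m B :: (nat \<times> nat, 'k::field) mpoly) \<noteq> 0"
proof -
  have "{E. matching {1..m} B E} \<noteq> {}"
    unfolding minor_expansion(3)[OF assms, symmetric] using permutes_id by blast
  then show ?thesis using keys_minor(1)[OF assms, where 'k='k] by force
qed

section \<open>Groebner bases and divisibility of leading monomials\<close>

lemma ring_ops [simp]:
  "\<zero>\<^bsub>poly_ring V\<^esub> = 0" "\<one>\<^bsub>poly_ring V\<^esub> = 1"
  "p \<oplus>\<^bsub>poly_ring V\<^esub> q = p + q" "p \<otimes>\<^bsub>poly_ring V\<^esub> q = p * q"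
  by (simp_all add: poly_ring_def)

lemma carrier_poly_ring: "p \<in> carrier (poly_ring V) \<longleftrightarrow> Poly_Mapping.keys p \<subseteq> monoms V"
  by (simp add: poly_ring_def)

lemma ideal_poly_ringI:
  fixes I :: "('x, 'k::field) mpoly set"
  assumes "I \<subseteq> carrier (poly_ring V)" "0 \<in> I" "\<And>p q. p \<in> I \<Longrightarrow> q \<in> I \<Longrightarrow> p + q \<in> I"
    and "\<And>c p. c \<in> carrier (poly_ring V) \<Longrightarrow> p \<in> I \<Longrightarrow> c * p \<in> I"
  shows "ideal I (poly_ring V)"
proof -
  interpret cring "poly_ring V :: ('x, 'k) mpoly ring" by (rule cring_poly_ring)
  have a_inv: "\<ominus>\<^bsub>poly_ring V\<^esub> p = - p" if "p \<in> carrier (poly_ring V)" for p :: "('x, 'k) mpoly"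
    using that by (intro minus_equality) (auto simp: carrier_poly_ring)
  have neg: "- p \<in> I" if "p \<in> I" for p
    using assms(4)[OF _ that, of "- 1"] by (simp add: carrier_poly_ring)
  show ?thesis
  proof (rule idealI)
    show "subgroup I (add_monoid (poly_ring V))"
    proof (rule add.subgroupI)
      show "\<ominus>\<^bsub>poly_ring V\<^esub> a \<in> I" if "a \<in> I" for a
        using a_inv[of a] neg[OF that] that assms(1) by auto
    qed (use assms in auto)
  next
    fix p c :: "('x, 'k) mpoly"
    assume "p \<in> I" "c \<in> carrier (poly_ring V)"
    then show "c \<otimes>\<^bsub>poly_ring V\<^esub> p \<in> I" "p \<otimes>\<^bsub>poly_ring V\<^esub> c \<in> I"
      using assms(4)[of c p] by (simp_all add: mult.commute)
  qed (rule ring_axioms)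
qed

lemma genideal_poly_ring:
  fixes F :: "('x, 'k::field) mpoly set"
  assumes F: "F \<subseteq> carrier (poly_ring V)"
  defines "I \<equiv> Idl\<^bsub>poly_ring V\<^esub> F"
  shows "F \<subseteq> I" "I \<subseteq> carrier (poly_ring V)" "0 \<in> I" "\<And>p q. p \<in> I \<Longrightarrow> q \<in> I \<Longrightarrow> p + q \<in> I"
    "\<And>c p. c \<in> carrier (poly_ring V) \<Longrightarrow> p \<in> I \<Longrightarrow> c * p \<in> I"
    "\<And>p q. p \<in> I \<Longrightarrow> q \<in> I \<Longrightarrow> p - q \<in> I"
    "\<And>A f. (\<And>a. a \<in> A \<Longrightarrow> f a \<in> I) \<Longrightarrow> sum f A \<in> I"
proof -
  interpret cring "poly_ring V :: ('x, 'k) mpoly ring" by (rule cring_poly_ring)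
  interpret ideal I "poly_ring V" unfolding I_def by (rule genideal_ideal[OF F])
  show "F \<subseteq> I" unfolding I_def by (rule genideal_self[OF F])
  show sub: "I \<subseteq> carrier (poly_ring V)" by (rule a_subset)
  show zero: "0 \<in> I" using zero_closed by simp
  show add: "p + q \<in> I" if "p \<in> I" "q \<in> I" for p q using a_closed[OF that] by simp
  show mult: "c * p \<in> I" if "c \<in> carrier (poly_ring V)" "p \<in> I" for c p using I_l_closed[OF that(2,1)] by simp
  show "p - q \<in> I" if "p \<in> I" "q \<in> I" for p q
    using add[OF that(1) mult[OF _ that(2), of "- 1"]] by (simp add: carrier_poly_ring)
  show "sum f A \<in> I" if "\<And>a. a \<in> A \<Longrightarrow> f a \<in> I" for A f
    using that by (induction A rule: infinite_finite_induct) (auto simp: zero add)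
qed

lemma genideal_minimal_poly_ring:
  fixes F :: "('x, 'k::field) mpoly set"
  assumes "F \<subseteq> I" "ideal I (poly_ring V)"
  shows "Idl\<^bsub>poly_ring V\<^esub> F \<subseteq> I"
  using assms by (auto simp: genideal_def)

lemma monomial_ideal_keys:
  fixes p :: "('x, 'k::field) mpoly"
  assumes M: "M \<subseteq> monoms V" and p: "p \<in> Idl\<^bsub>poly_ring V\<^esub> (msingle ` M)" and t: "t \<in> Poly_Mapping.keys p"
  shows "\<exists>s \<in> M. monom_dvd s t"
proof -
  define I where "I = {p \<in> carrier (poly_ring V) :: ('x, 'k) mpoly set. \<forall>t \<in> Poly_Mapping.keys p. \<exists>s \<in> M. monom_dvd s t}"
  have "ideal I (poly_ring V)"
  proof (rule ideal_poly_ringI)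
    fix p q assume pq: "p \<in> I" "q \<in> I"
    have "Poly_Mapping.keys (p + q) \<subseteq> Poly_Mapping.keys p \<union> Poly_Mapping.keys q" by (rule keys_add)
    with pq show "p + q \<in> I" unfolding I_def carrier_poly_ring by blast
  next
    fix c p :: "('x, 'k) mpoly"
    assume c: "c \<in> carrier (poly_ring V)" and p: "p \<in> I"
    have "\<exists>s \<in> M. monom_dvd s t" if t: "t \<in> Poly_Mapping.keys (c * p)" for t
    proof -
      obtain a b where ab: "b \<in> Poly_Mapping.keys p" "t = a + b" using t keys_mult[of c p] by auto
      then obtain s where "s \<in> M" "monom_dvd s b" using p by (auto simp: I_def)
      then show ?thesis using ab(2) unfolding monom_dvd_def by (metis add.left_commute)
    qed
    moreover have "c * p \<in> carrier (poly_ring V)" using c p poly_mult_closed[of c V p] by (auto simp: I_def carrier_poly_ring)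
    ultimately show "c * p \<in> I" by (simp add: I_def)
  qed (auto simp: I_def carrier_poly_ring)
  moreover have "msingle ` M \<subseteq> I" using M by (force simp: I_def carrier_poly_ring monom_dvd_def)
  ultimately have "p \<in> I" using genideal_minimal_poly_ring p by blast
  then show ?thesis using t by (auto simp: I_def)
qed

text \<open>
  An ideal generated by monomials contains a monomial only if one of the generators divides it.
  This turns the equality of initial ideals into a divisibility condition on single elements.
\<close>

lemma groebner_basis_iff:
  fixes G I :: "('x, 'k::field) mpoly set"
  assumes r: "term_order V r" and I: "I \<subseteq> carrier (poly_ring V)" and G: "finite G" "G \<subseteq> I"
  shows "groebner_basis V r G I \<longleftrightarrow>
    (\<forall>f \<in> I - {0}. \<exists>g \<in> G - {0}. monom_dvd (lead_monom r g) (lead_monom r f))"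
proof -
  define leads where "leads F = lead_monom r ` (F - {0})" for F :: "('x, 'k) mpoly set"
  have init: "initial_ideal V r F = Idl\<^bsub>poly_ring V\<^esub> (msingle ` leads F)" for F :: "('x, 'k) mpoly set"
    unfolding initial_ideal_def leads_def by (rule arg_cong[where f="genideal (poly_ring V)"]) auto
  have leads: "leads F \<subseteq> monoms V" if "F \<subseteq> I" for F
    using lead_monom_in_keys(1)[OF r] that I by (force simp: leads_def carrier_poly_ring)
  have sub: "msingle ` M \<subseteq> (carrier (poly_ring V) :: ('x, 'k) mpoly set)" if "M \<subseteq> monoms V" for M :: "'x monom set"
    using that by (auto simp: carrier_poly_ring)
  show ?thesis
  proof
    assume "groebner_basis V r G I"
    then have eq: "initial_ideal V r G = initial_ideal V r I" by (simp add: groebner_basis_def)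
    show "\<forall>f \<in> I - {0}. \<exists>g \<in> G - {0}. monom_dvd (lead_monom r g) (lead_monom r f)"
    proof
      fix f assume "f \<in> I - {0}"
      then have "msingle (lead_monom r f) \<in> (initial_ideal V r I :: ('x, 'k) mpoly set)"
        unfolding init using genideal_poly_ring(1)[OF sub[OF leads[OF subset_refl]]] by (auto simp: leads_def)
      then have "msingle (lead_monom r f) \<in> Idl\<^bsub>poly_ring V\<^esub> (msingle ` leads G :: ('x, 'k) mpoly set)" using eq by (simp add: init)
      from monomial_ideal_keys[OF leads[OF G(2)] this, of "lead_monom r f"]
      show "\<exists>g \<in> G - {0}. monom_dvd (lead_monom r g) (lead_monom r f)" by (auto simp: leads_def)
    qed
  next
    assume R: "\<forall>f \<in> I - {0}. \<exists>g \<in> G - {0}. monom_dvd (lead_monom r g) (lead_monom r f)"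
    have "initial_ideal V r G \<subseteq> initial_ideal V r I"
      unfolding init
    proof (rule genideal_minimal_poly_ring)
      show "msingle ` leads G \<subseteq> Idl\<^bsub>poly_ring V\<^esub> (msingle ` leads I :: ('x, 'k) mpoly set)"
        using genideal_poly_ring(1)[OF sub[OF leads[OF subset_refl]]] G(2) by (auto simp: leads_def)
      show "ideal (Idl\<^bsub>poly_ring V\<^esub> (msingle ` leads I :: ('x, 'k) mpoly set)) (poly_ring V)"
        by (intro ring.genideal_ideal cring.axioms(1) cring_poly_ring sub leads subset_refl)
    qed
    moreover have "initial_ideal V r I \<subseteq> initial_ideal V r G"
      unfolding init
    proof (rule genideal_minimal_poly_ring)
      show "ideal (Idl\<^bsub>poly_ring V\<^esub> (msingle ` leads G :: ('x, 'k) mpoly set)) (poly_ring V)"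
        by (intro ring.genideal_ideal cring.axioms(1) cring_poly_ring sub leads G)
      show "msingle ` leads I \<subseteq> Idl\<^bsub>poly_ring V\<^esub> (msingle ` leads G :: ('x, 'k) mpoly set)"
      proof
        fix p :: "('x, 'k) mpoly"
        assume "p \<in> msingle ` leads I"
        then obtain f where f: "f \<in> I - {0}" "p = msingle (lead_monom r f)" by (auto simp: leads_def)
        then obtain g u where g: "g \<in> G - {0}" "lead_monom r f = lead_monom r g + u"
          using bspec[OF R f(1)] unfolding monom_dvd_def by blast
        have "lead_monom r f \<in> monoms V" using leads[OF subset_refl] f by (auto simp: leads_def)
        then have "u \<in> monoms V" unfolding g(2) by (auto simp: monoms_def in_keys_iff lookup_add)
        then have "msingle u * msingle (lead_monom r g) \<in> Idl\<^bsub>poly_ring V\<^esub> (msingle ` leads G :: ('x, 'k) mpoly set)"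
          using g(1) genideal_poly_ring(1)[OF sub[OF leads[OF G(2)]]]
          by (intro genideal_poly_ring(5)[OF sub[OF leads[OF G(2)]]]) (auto simp: leads_def carrier_poly_ring)
        then show "p \<in> Idl\<^bsub>poly_ring V\<^esub> (msingle ` leads G)" by (simp add: f(2) g(2) mult_single add.commute)
      qed
    qed
    ultimately show "groebner_basis V r G I" using G by (simp add: groebner_basis_def)
  qed
qed

section \<open>Weights that represent a term order\<close>

definition weight :: "('x \<Rightarrow> real) \<Rightarrow> 'x monom \<Rightarrow> real" where
  "weight \<omega> s = (\<Sum>x\<in>Poly_Mapping.keys s. \<omega> x * Poly_Mapping.lookup s x)"

lemma weight_superset:
  "finite A \<Longrightarrow> Poly_Mapping.keys s \<subseteq> A \<Longrightarrow> weight \<omega> s = (\<Sum>x\<in>A. \<omega> x * Poly_Mapping.lookup s x)"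
  unfolding weight_def by (rule sum.mono_neutral_left) (auto simp: in_keys_iff)

lemma weight_add: "weight \<omega> (s + t) = weight \<omega> s + weight \<omega> t"
proof -
  let ?A = "Poly_Mapping.keys s \<union> Poly_Mapping.keys t"
  have "weight \<omega> (s + t) = (\<Sum>x\<in>?A. \<omega> x * Poly_Mapping.lookup (s + t) x)"
    by (intro weight_superset) (auto simp: keys_add)
  also have "\<dots> = weight \<omega> s + weight \<omega> t"
    by (simp add: weight_superset[of ?A] lookup_add distrib_left sum.distrib)
  finally show ?thesis .
qed

lemma weight_sqfree_monom: "finite E \<Longrightarrow> weight \<omega> (sqfree_monom E) = (\<Sum>x\<in>E. \<omega> x)"
  by (simp add: weight_def lookup_sqfree_monom)

text \<open>
  Only finitely many comparisons matter in each argument below, and those can be read off from a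
  real weight: the exponent differences \<open>t - s\<close> with \<open>s\<close> strictly below \<open>t\<close> are closed under
  addition and never \<open>0\<close>, because the order is compatible with multiplication.
\<close>

lemma term_order_weight:
  assumes V: "finite V" and r: "term_order V r" and S: "finite S"
    and S_r: "\<And>s t. (s, t) \<in> S \<Longrightarrow> s \<in> monoms V \<and> t \<in> monoms V \<and> s \<noteq> t \<and> (s, t) \<in> r"
  obtains \<omega> where "\<And>s t. (s, t) \<in> S \<Longrightarrow> weight \<omega> s < weight \<omega> t"
proof -
  define D :: "'a monom \<times> 'a monom \<Rightarrow> 'a \<Rightarrow> int"
    where "D = (\<lambda>(s, t) x. int (Poly_Mapping.lookup t x) - int (Poly_Mapping.lookup s x))"
  define C where "C = D ` {(s, t). s \<in> monoms V \<and> t \<in> monoms V \<and> s \<noteq> t \<and> (s, t) \<in> r}"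
  have lin: "antisym r" "trans r" using r by (auto simp: term_order_def order_on_defs)
  have tr: "(s + u, t + u) \<in> r" if "s \<in> monoms V" "t \<in> monoms V" "u \<in> monoms V" "(s, t) \<in> r" for s t u
    using r that by (auto simp: term_order_def)
  have "\<exists>\<omega> :: 'a \<Rightarrow> real. \<forall>d \<in> D ` S. (\<Sum>x\<in>V. \<omega> x * d x) > 0"
  proof (rule positive_weight_exists[OF V])
    show "finite (D ` S)" using S by simp
    show "D ` S \<subseteq> C" unfolding C_def using S_r by (intro image_mono) auto
    show "(\<lambda>x. d x + e x) \<in> C" if de: "d \<in> C" "e \<in> C" for d e
    proof -
      obtain s t s' t' where st: "d = D (s, t)" "s \<in> monoms V" "t \<in> monoms V" "s \<noteq> t" "(s, t) \<in> r"
        and st': "e = D (s', t')" "s' \<in> monoms V" "t' \<in> monoms V" "s' \<noteq> t'" "(s', t') \<in> r"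
        using de by (auto simp: C_def)
      have 1: "(s + s', t + s') \<in> r" using tr st st' by blast
      have 2: "(t + s', t + t') \<in> r" using tr[OF st'(2,3) st(3) st'(5)] by (simp add: add.commute)
      have 3: "(s + s', t + t') \<in> r" using 1 2 lin(2) by (meson transD)
      have 4: "s + s' \<noteq> t + t'"
      proof
        assume "s + s' = t + t'"
        then have "s + s' = t + s'" using 1 2 lin(1) by (auto dest: antisymD)
        then show False using st(4) by simp
      qed
      have "(\<lambda>x. d x + e x) = D (s + s', t + t')" by (auto simp: st st' D_def lookup_add)
      then show ?thesis using 3 4 monoms_add st st' unfolding C_def by blast
    qed
    show "(\<lambda>x. 0) \<notin> C"
    proof
      assume "(\<lambda>x. 0) \<in> C"
      then obtain s t where "(\<lambda>x. 0) = D (s, t)" "s \<noteq> t" by (auto simp: C_def)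
      then have "\<forall>x. Poly_Mapping.lookup t x = Poly_Mapping.lookup s x" by (auto simp: D_def fun_eq_iff)
      then show False using \<open>s \<noteq> t\<close> by (metis poly_mapping_eqI)
    qed
    show "d x = 0" if d: "d \<in> D ` S" "x \<notin> V" for d x
    proof -
      obtain s t where "d = D (s, t)" "s \<in> monoms V" "t \<in> monoms V" using d S_r by auto
      moreover from this have "x \<notin> Poly_Mapping.keys s" "x \<notin> Poly_Mapping.keys t"
        using \<open>x \<notin> V\<close> by (auto simp: monoms_def)
      ultimately show ?thesis by (simp add: D_def in_keys_iff)
    qed
  qed
  then obtain \<omega> :: "'a \<Rightarrow> real" where \<omega>: "\<And>d. d \<in> D ` S \<Longrightarrow> (\<Sum>x\<in>V. \<omega> x * d x) > 0" by blast
  have "weight \<omega> s < weight \<omega> t" if st: "(s, t) \<in> S" for s t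
  proof -
    have "weight \<omega> t - weight \<omega> s = (\<Sum>x\<in>V. \<omega> x * D (s, t) x)"
      using S_r[OF st] V by (simp add: weight_superset[of V] monoms_def D_def algebra_simps sum_subtractf)
    then show ?thesis using \<omega>[of "D (s, t)"] st by simp
  qed
  then show thesis by (rule that)
qed

section \<open>Evaluation of polynomials and singular matrices\<close>

definition monom_eval :: "('x \<Rightarrow> 'a::comm_ring_1) \<Rightarrow> 'x monom \<Rightarrow> 'a" where
  "monom_eval y s = (\<Prod>x\<in>Poly_Mapping.keys s. y x ^ Poly_Mapping.lookup s x)"

definition poly_eval :: "('k::field \<Rightarrow> 'a::comm_ring_1) \<Rightarrow> ('x \<Rightarrow> 'a) \<Rightarrow> ('x, 'k) mpoly \<Rightarrow> 'a" where
  "poly_eval c y p = (\<Sum>s\<in>Poly_Mapping.keys p. c (Poly_Mapping.lookup p s) * monom_eval y s)"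

lemma monom_eval_superset:
  "finite A \<Longrightarrow> Poly_Mapping.keys s \<subseteq> A \<Longrightarrow> monom_eval y s = (\<Prod>x\<in>A. y x ^ Poly_Mapping.lookup s x)"
  unfolding monom_eval_def by (rule prod.mono_neutral_left) (auto simp: in_keys_iff)

lemma monom_eval_add: "monom_eval y (s + t) = monom_eval y s * monom_eval y t"
proof -
  let ?A = "Poly_Mapping.keys s \<union> Poly_Mapping.keys t"
  have "monom_eval y (s + t) = (\<Prod>x\<in>?A. y x ^ Poly_Mapping.lookup (s + t) x)"
    by (intro monom_eval_superset) (auto simp: keys_add)
  also have "\<dots> = monom_eval y s * monom_eval y t"
    by (simp add: monom_eval_superset[of ?A] lookup_add power_add prod.distrib)
  finally show ?thesis .
qed

lemma poly_mapping_sum_single: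
  fixes p :: "'a \<Rightarrow>\<^sub>0 'b::comm_monoid_add"
  shows "(\<Sum>s\<in>Poly_Mapping.keys p. Poly_Mapping.single s (Poly_Mapping.lookup p s)) = p"
proof (rule poly_mapping_eqI)
  fix t
  have "(\<Sum>s\<in>Poly_Mapping.keys p. Poly_Mapping.lookup p s when s = t) =
      (\<Sum>s\<in>Poly_Mapping.keys p. if s = t then Poly_Mapping.lookup p s else 0)"
    by (intro sum.cong) (auto simp: when_def)
  then show "Poly_Mapping.lookup (\<Sum>s\<in>Poly_Mapping.keys p. Poly_Mapping.single s (Poly_Mapping.lookup p s)) t =
      Poly_Mapping.lookup p t"
    by (simp add: lookup_sum lookup_single in_keys_iff)
qed

lemma comm_ring_hom_poly_eval:
  fixes c :: "'k::field \<Rightarrow> 'a::comm_ring_1" and y :: "'x \<Rightarrow> 'a"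
  assumes "comm_ring_hom c"
  shows "comm_ring_hom (poly_eval c y)"
proof -
  interpret c: comm_ring_hom c by fact
  have superset: "poly_eval c y p = (\<Sum>s\<in>A. c (Poly_Mapping.lookup p s) * monom_eval y s)"
    if "finite A" "Poly_Mapping.keys p \<subseteq> A" for A p
    unfolding poly_eval_def by (rule sum.mono_neutral_left) (use that in \<open>auto simp: in_keys_iff\<close>)
  have add: "poly_eval c y (p + q) = poly_eval c y p + poly_eval c y q" for p q
  proof -
    let ?A = "Poly_Mapping.keys p \<union> Poly_Mapping.keys q"
    have "poly_eval c y (p + q) = (\<Sum>s\<in>?A. c (Poly_Mapping.lookup (p + q) s) * monom_eval y s)"
      by (intro superset) (auto simp: keys_add)
    then show ?thesis
      by (simp add: superset[of ?A] lookup_add c.hom_add distrib_right sum.distrib)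
  qed
  have zero: "poly_eval c y 0 = 0" by (simp add: poly_eval_def)
  have sum: "poly_eval c y (sum f A) = (\<Sum>a\<in>A. poly_eval c y (f a))" for f :: "'b \<Rightarrow> _" and A
    by (induction A rule: infinite_finite_induct) (simp_all add: zero add)
  have single: "poly_eval c y (Poly_Mapping.single s a) = c a * monom_eval y s" for s a
    by (cases "a = 0") (simp_all add: poly_eval_def)
  have mult: "poly_eval c y (p * q) = poly_eval c y p * poly_eval c y q" for p q
  proof -
    have "p * q = (\<Sum>s\<in>Poly_Mapping.keys p. \<Sum>t\<in>Poly_Mapping.keys q.
        Poly_Mapping.single (s + t) (Poly_Mapping.lookup p s * Poly_Mapping.lookup q t))"
      by (subst (1 2) poly_mapping_sum_single[symmetric]) (simp add: sum_product mult_single)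
    then have "poly_eval c y (p * q) = (\<Sum>s\<in>Poly_Mapping.keys p. \<Sum>t\<in>Poly_Mapping.keys q.
        (c (Poly_Mapping.lookup p s) * monom_eval y s) * (c (Poly_Mapping.lookup q t) * monom_eval y t))"
      by (simp only: sum single monom_eval_add c.hom_mult mult_ac)
    then show ?thesis by (simp add: poly_eval_def sum_product)
  qed
  have one: "poly_eval c y 1 = 1"
    using single[of 0 1] by (simp add: monom_eval_def c.hom_one)
  show ?thesis by unfold_locales (simp_all add: zero one add mult)
qed

lemma poly_eval_X_entry:
  assumes "comm_ring_hom c"
  shows "poly_eval c y (X_entry i j) = y (i, j)"
proof -
  interpret comm_ring_hom c by fact
  show ?thesis by (simp add: poly_eval_def X_entry_def monom_eval_def)
qed

text \<open>
  Over a commutative ring, \<open>u A = 0\<close> gives \<open>det A * u = 0\<close> after multiplication by the adjugate;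
  a unit entry of \<open>u\<close> then kills the determinant.
\<close>

lemma det_eq_0_if_left_kernel:
  fixes A :: "'a::comm_ring_1 mat"
  assumes A: "A \<in> carrier_mat m m"
    and ker: "\<And>j. j < m \<Longrightarrow> (\<Sum>i<m. u i * A $$ (i, j)) = 0"
    and unit: "h < m" "u h * u' = 1"
  shows "det A = 0"
proof -
  have adj: "adj_mat A \<in> carrier_mat m m" using adj_mat(1)[OF A] .
  have "(\<Sum>i<m. u i * (A * adj_mat A) $$ (i, h)) = (\<Sum>i<m. u i * (\<Sum>j<m. A $$ (i, j) * adj_mat A $$ (j, h)))"
    using A adj unit(1) by (intro sum.cong) (auto simp: scalar_prod_def atLeast0LessThan)
  also have "\<dots> = (\<Sum>j<m. (\<Sum>i<m. u i * A $$ (i, j)) * adj_mat A $$ (j, h))"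
    unfolding sum_distrib_left sum_distrib_right mult.assoc by (rule sum.swap)
  also have "\<dots> = 0" by (intro sum.neutral) (simp add: ker)
  finally have "(\<Sum>i<m. u i * (A * adj_mat A) $$ (i, h)) = 0" .
  moreover have "(\<Sum>i<m. u i * (A * adj_mat A) $$ (i, h)) = (\<Sum>i<m. if i = h then u h * det A else 0)"
    unfolding adj_mat(2)[OF A] using unit(1) by (intro sum.cong) auto
  ultimately have "u h * det A = 0" using unit(1) by simp
  then have "(u h * u') * det A = 0" by (metis mult.commute mult.left_commute mult_zero_right)
  then show ?thesis using unit(2) by simp
qed

section \<open>Leading coefficients with real exponents\<close>

text \<open>
  The real exponents are powers of a formal parameter whose highest power dominates. The
  coefficient \<open>a\<close> may be \<open>0\<close>, so that \<open>leading e a p\<close> is only an upper bound for the degree of \<open>p\<close>.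
\<close>

definition leading :: "real \<Rightarrow> 'a \<Rightarrow> (real \<Rightarrow>\<^sub>0 'a::comm_ring_1) \<Rightarrow> bool" where
  "leading e a p \<longleftrightarrow> (\<forall>d \<in> Poly_Mapping.keys p. d \<le> e) \<and> Poly_Mapping.lookup p e = a"

lemma leading_single [simp]: "leading e a (Poly_Mapping.single e a)"
  by (simp add: leading_def)

lemma leading_mult:
  assumes p: "leading d a p" and q: "leading e b q"
  shows "leading (d + e) (a * b) (p * q)"
proof -
  define p' q' where "p' = p - Poly_Mapping.single d a" and "q' = q - Poly_Mapping.single e b"
  have p': "\<forall>x \<in> Poly_Mapping.keys p'. x < d"
    using p by (auto simp: leading_def p'_def in_keys_iff lookup_minus lookup_single when_def less_le split: if_splits)
  have q': "\<forall>x \<in> Poly_Mapping.keys q'. x < e"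
    using q by (auto simp: leading_def q'_def in_keys_iff lookup_minus lookup_single when_def less_le split: if_splits)
  define rest where "rest = Poly_Mapping.single d a * q' + p' * q"
  have eq: "p * q = Poly_Mapping.single (d + e) (a * b) + rest"
    by (simp add: rest_def p'_def q'_def algebra_simps mult_single)
  have "\<forall>x \<in> Poly_Mapping.keys rest. x < d + e"
  proof
    fix x assume "x \<in> Poly_Mapping.keys rest"
    then consider "x \<in> Poly_Mapping.keys (Poly_Mapping.single d a * q')" | "x \<in> Poly_Mapping.keys (p' * q)"
      using keys_add[of "Poly_Mapping.single d a * q'" "p' * q"] by (auto simp: rest_def)
    then show "x < d + e"
    proof cases
      case 1
      then obtain y where "y \<in> Poly_Mapping.keys q'" "x = d + y"
        using keys_mult[of "Poly_Mapping.single d a" q'] by (auto split: if_splits)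
      then show ?thesis using q' by simp
    next
      case 2
      then obtain y z where "y \<in> Poly_Mapping.keys p'" "z \<in> Poly_Mapping.keys q" "x = y + z"
        using keys_mult[of p' q] by blast
      then show ?thesis using p' q by (force simp: leading_def)
    qed
  qed
  then have rest: "Poly_Mapping.lookup rest x = 0" if "x \<ge> d + e" for x
    using that by (meson in_keys_iff not_le)
  have "x \<le> d + e" if "x \<in> Poly_Mapping.keys (p * q)" for x
  proof (rule ccontr)
    assume "\<not> x \<le> d + e"
    then have "Poly_Mapping.lookup (p * q) x = 0"
      unfolding eq using rest[of x] by (simp add: lookup_add lookup_single when_def)
    then show False using that by (simp add: in_keys_iff)
  qed
  moreover have "Poly_Mapping.lookup (p * q) (d + e) = a * b"
    unfolding eq using rest[of "d + e"] by (simp add: lookup_add)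
  ultimately show ?thesis by (simp add: leading_def)
qed

lemma leading_power: "leading e a p \<Longrightarrow> leading (real n * e) (a ^ n) (p ^ n)"
proof (induction n)
  case 0
  show ?case using leading_single[of 0 1] by simp
next
  case (Suc n)
  then show ?case using leading_mult[of e a p "real n * e" "a ^ n" "p ^ n"] by (simp add: algebra_simps)
qed

lemma leading_monom_eval:
  assumes "\<And>x. x \<in> Poly_Mapping.keys s \<Longrightarrow> leading (\<omega> x) (z x) (y x)"
  shows "leading (weight \<omega> s) (monom_eval z s) (monom_eval y s)"
proof -
  have "leading (\<Sum>x\<in>A. \<omega> x * Poly_Mapping.lookup s x) (\<Prod>x\<in>A. z x ^ Poly_Mapping.lookup s x)
      (\<Prod>x\<in>A. y x ^ Poly_Mapping.lookup s x)" if "finite A" "A \<subseteq> Poly_Mapping.keys s" for A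
    using that
  proof (induction A rule: finite_induct)
    case empty
    show ?case using leading_single[of 0 1] by simp
  next
    case (insert x A)
    then show ?case
      using leading_mult[OF leading_power[OF assms[of x], of "Poly_Mapping.lookup s x"] insert.IH]
      by (simp add: mult.commute[of "\<omega> x"])
  qed
  then show ?thesis by (simp add: weight_def monom_eval_def)
qed

text \<open>
  A generic column \<open>y\<close> of the weighted degrees \<open>\<omega>\<close> orthogonal to the vector of powers \<open>v\<close>: pick
  a row \<open>h\<close> where \<open>v + \<omega>\<close> is maximal on \<open>I\<close>, choose the other entries freely and solve for the entry
  in row \<open>h\<close>. Maximality keeps the degree of that entry at most \<open>\<omega> h\<close>. If the maximum is attained
  twice, its leading coefficient is a nonempty sum of free coefficients; if it is attained only
  at \<open>h\<close>, the coefficient is \<open>0\<close>, which the hypothesis permits only when \<open>W h\<close> fails. Powers of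
  the polynomial variable serve as free coefficients, since \<open>'k\<close> may be a finite field.
\<close>

lemma kernel_column:
  fixes \<omega> v :: "nat \<Rightarrow> real" and W :: "nat \<Rightarrow> bool"
  assumes I: "finite I" "I \<noteq> {}" and W: "\<And>i. i \<in> I \<Longrightarrow> W i \<Longrightarrow> \<exists>k \<in> I - {i}. v i + \<omega> i \<le> v k + \<omega> k"
  shows "\<exists>y z. (\<forall>i. leading (\<omega> i) (z i) (y i)) \<and> (\<forall>i. W i \<longrightarrow> z i \<noteq> 0) \<and>
    (\<Sum>i\<in>I. Poly_Mapping.single (v i) 1 * y i) = (0 :: real \<Rightarrow>\<^sub>0 'k::field poly)"
proof -
  have "Max ((\<lambda>i. v i + \<omega> i) ` I) \<in> (\<lambda>i. v i + \<omega> i) ` I" using I by (intro Max_in) auto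
  then obtain h where h: "h \<in> I" "v h + \<omega> h = Max ((\<lambda>i. v i + \<omega> i) ` I)" by auto
  have hmax: "v k + \<omega> k \<le> v h + \<omega> h" if "k \<in> I" for k unfolding h(2) using I that by simp
  define Y :: "real \<Rightarrow>\<^sub>0 'k poly" where
    "Y = - (\<Sum>k\<in>I - {h}. Poly_Mapping.single (v k - v h + \<omega> k) (monom 1 k))"
  define Z :: "'k poly" where "Z = - (\<Sum>k\<in>{k \<in> I - {h}. v k + \<omega> k = v h + \<omega> h}. monom 1 k)"
  define y where "y i = (if i = h then Y else Poly_Mapping.single (\<omega> i) (monom 1 i))" for i
  define z where "z i = (if i = h then Z else monom 1 i)" for i
  have "leading (\<omega> h) Z Y"
  proof -
    have "d \<le> \<omega> h" if d: "d \<in> Poly_Mapping.keys Y" for d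
    proof -
      obtain k where "k \<in> I - {h}" "d = v k - v h + \<omega> k"
        using d keys_sum[of "\<lambda>k. Poly_Mapping.single (v k - v h + \<omega> k) (monom (1 :: 'k) k)" "I - {h}"]
        by (auto simp: Y_def split: if_splits)
      then show ?thesis using hmax[of k] by simp
    qed
    moreover have "Poly_Mapping.lookup Y (\<omega> h) = Z"
    proof -
      have "(\<Sum>k\<in>I - {h}. monom (1 :: 'k) k when v k - v h + \<omega> k = \<omega> h) =
          (\<Sum>k\<in>{k \<in> I - {h}. v k + \<omega> k = v h + \<omega> h}. monom 1 k)"
        using I(1) by (intro sum.mono_neutral_cong_right) (auto simp: when_def)
      then show ?thesis by (simp add: Y_def Z_def lookup_sum lookup_single)
    qed
    ultimately show ?thesis by (simp add: leading_def)
  qed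
  then have "\<forall>i. leading (\<omega> i) (z i) (y i)" by (simp add: y_def z_def)
  moreover have "Z \<noteq> 0" if "W h"
  proof -
    obtain k where k: "k \<in> I - {h}" "v h + \<omega> h \<le> v k + \<omega> k" using W[OF h(1) \<open>W h\<close>] by blast
    then have "v k + \<omega> k = v h + \<omega> h" using hmax[of k] by auto
    then have "coeff Z k = - (\<Sum>k'\<in>{k \<in> I - {h}. v k + \<omega> k = v h + \<omega> h}. if k' = k then 1 else 0)"
      by (simp add: Z_def coeff_sum)
    also have "\<dots> = - 1" using k \<open>v k + \<omega> k = v h + \<omega> h\<close> I(1) by (subst sum.delta) auto
    finally show ?thesis by auto
  qed
  then have "\<forall>i. W i \<longrightarrow> z i \<noteq> 0" by (simp add: z_def monom_eq_0_iff)
  moreover have "(\<Sum>i\<in>I. Poly_Mapping.single (v i) 1 * y i) = 0"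
  proof -
    have "(\<Sum>i\<in>I - {h}. Poly_Mapping.single (v i) 1 * y i) =
        (\<Sum>i\<in>I - {h}. Poly_Mapping.single (v h) 1 * Poly_Mapping.single (v i - v h + \<omega> i) (monom 1 i))"
      by (intro sum.cong) (auto simp: y_def mult_single)
    also have "\<dots> = - (Poly_Mapping.single (v h) 1 * y h)" by (simp add: y_def Y_def sum_distrib_left)
    finally show ?thesis using I(1) h(1) by (simp add: sum.remove[of I h])
  qed
  ultimately show ?thesis by blast
qed

section \<open>Minors of a disjoint union of cliques\<close>

lemma J_ideal_facts:
  fixes m n and \<Delta> :: "nat set set"
  assumes "pure_hypergraph m n \<Delta>"
  defines "J \<equiv> (J_ideal m n \<Delta> :: (nat \<times> nat, 'k::field) mpoly set)"
  shows "minors m \<Delta> \<subseteq> (carrier (poly_ring (gen_vars m n)) :: (nat \<times> nat, 'k) mpoly set)"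
    "finite \<Delta>" "minors m \<Delta> \<subseteq> J" "J \<subseteq> carrier (poly_ring (gen_vars m n))" "finite (minors m \<Delta> :: (nat \<times> nat, 'k) mpoly set)"
proof -
  show sub: "minors m \<Delta> \<subseteq> (carrier (poly_ring (gen_vars m n)) :: (nat \<times> nat, 'k) mpoly set)"
    using assms(1) minor_in_carrier unfolding minors_def pure_hypergraph_def by blast
  have "\<Delta> \<subseteq> Pow {1..n}" using assms(1) by (auto simp: pure_hypergraph_def)
  then show "finite \<Delta>" by (rule finite_subset) simp
  then show "finite (minors m \<Delta> :: (nat \<times> nat, 'k) mpoly set)" by (simp add: minors_def)
  show "minors m \<Delta> \<subseteq> J" "J \<subseteq> carrier (poly_ring (gen_vars m n))"
    unfolding J_def J_ideal_def by (rule genideal_poly_ring[OF sub])+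
qed

lemma groebner_minors_iff:
  assumes r: "term_order (gen_vars m n) r" and \<Delta>: "pure_hypergraph m n \<Delta>"
  shows "groebner_basis (gen_vars m n) r (minors m \<Delta> :: (nat \<times> nat, 'k::field) mpoly set) (J_ideal m n \<Delta>) \<longleftrightarrow>
    (\<forall>f \<in> J_ideal m n \<Delta> :: (nat \<times> nat, 'k) mpoly set. f \<noteq> 0 \<longrightarrow>
      (\<exists>B \<in> \<Delta>. monom_dvd (lead_monom r (minor m B :: (nat \<times> nat, 'k) mpoly)) (lead_monom r f)))"
proof -
  have "(minor m B :: (nat \<times> nat, 'k) mpoly) \<noteq> 0" if "B \<in> \<Delta>" for B
    using that \<Delta> by (intro minor_nonzero) (auto simp: pure_hypergraph_def intro: finite_subset)
  then show ?thesis
    unfolding groebner_basis_iff[OF r J_ideal_facts(4,5,3)[OF \<Delta>]] by (force simp: minors_def)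
qed

text \<open>
  Substitute for the generic matrix one whose columns in each clique \<open>T\<close> are orthogonal to the
  vector with entries of degree \<open>v T\<close> on \<open>I T\<close>. All minors of \<open>\<Delta>\<close> vanish there, hence so does \<open>f\<close>.
  The entries at the cells of \<open>w\<close> have exact degree \<open>\<omega>\<close> and the other entries at most that, so the
  monomial \<open>w\<close> would contribute a term of degree \<open>weight \<omega> w\<close> that nothing cancels. Disjointness
  of \<open>\<T>\<close> is what allows the columns to be chosen clique by clique.
\<close>

lemma no_strictly_heaviest_monomial:
  fixes f :: "(nat \<times> nat, 'k::field) mpoly" and \<omega> :: "nat \<times> nat \<Rightarrow> real" and v :: "nat set \<Rightarrow> nat \<Rightarrow> real"
  assumes \<Delta>: "pure_hypergraph m n \<Delta>" and \<T>: "disjoint \<T>" "\<Delta> = (\<Union>T \<in> \<T>. clique m T)"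
    and f: "f \<in> J_ideal m n \<Delta>" "w \<in> Poly_Mapping.keys f"
    and heaviest: "\<And>s. s \<in> Poly_Mapping.keys f \<Longrightarrow> s \<noteq> w \<Longrightarrow> weight \<omega> s < weight \<omega> w"
    and I: "\<And>T. T \<in> \<T> \<Longrightarrow> I T \<subseteq> {1..m} \<and> I T \<noteq> {}"
    and ties: "\<And>T i j. T \<in> \<T> \<Longrightarrow> j \<in> T \<Longrightarrow> i \<in> I T \<Longrightarrow> (i, j) \<in> Poly_Mapping.keys w \<Longrightarrow>
      \<exists>k \<in> I T - {i}. v T i + \<omega> (i, j) \<le> v T k + \<omega> (k, j)"
  shows False
proof -
  define good where "good j y z \<longleftrightarrow>
      (\<forall>i. leading (\<omega> (i, j)) (z i) (y i)) \<and> (\<forall>i. (i, j) \<in> Poly_Mapping.keys w \<longrightarrow> z i \<noteq> 0) \<and>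
      (\<forall>T \<in> \<T>. j \<in> T \<longrightarrow> (\<Sum>i\<in>I T. Poly_Mapping.single (v T i) 1 * y i) = 0)"
    for j and y :: "nat \<Rightarrow> real \<Rightarrow>\<^sub>0 'k poly" and z
  have "\<exists>y z. good j y z" for j
  proof (cases "\<exists>T \<in> \<T>. j \<in> T")
    case True
    then obtain T where T: "T \<in> \<T>" "j \<in> T" by blast
    have uniq: "T' = T" if "T' \<in> \<T>" "j \<in> T'" for T'
      using disjointD[OF \<T>(1) that(1) T(1)] T(2) that(2) by blast
    have "finite (I T)" "I T \<noteq> {}" using I[OF T(1)] finite_subset by auto
    then obtain y :: "nat \<Rightarrow> real \<Rightarrow>\<^sub>0 'k poly" and z where yz: "\<forall>i. leading (\<omega> (i, j)) (z i) (y i)"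
        "\<forall>i. (i, j) \<in> Poly_Mapping.keys w \<longrightarrow> z i \<noteq> 0"
        "(\<Sum>i\<in>I T. Poly_Mapping.single (v T i) 1 * y i) = 0"
      using kernel_column[of "I T" "\<lambda>i. (i, j) \<in> Poly_Mapping.keys w" "v T" "\<lambda>i. \<omega> (i, j)"]
        ties[OF T] by blast
    have "\<forall>T' \<in> \<T>. j \<in> T' \<longrightarrow> (\<Sum>i\<in>I T'. Poly_Mapping.single (v T' i) 1 * y i) = 0"
      using uniq yz(3) by blast
    then have "good j y z" unfolding good_def using yz(1,2) by blast
    then show ?thesis by blast
  next
    case False
    then have "good j (\<lambda>i. Poly_Mapping.single (\<omega> (i, j)) 1) (\<lambda>i. 1)" by (auto simp: good_def)
    then show ?thesis by blast
  qed
  then obtain y z where "\<And>j. good j (y j) (z j)" by metis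
  then have yz: "\<And>i j. leading (\<omega> (i, j)) (z j i) (y j i)"
      "\<And>i j. (i, j) \<in> Poly_Mapping.keys w \<Longrightarrow> z j i \<noteq> 0"
      "\<And>T j. T \<in> \<T> \<Longrightarrow> j \<in> T \<Longrightarrow> (\<Sum>i\<in>I T. Poly_Mapping.single (v T i) 1 * y j i) = 0"
    unfolding good_def by blast+
  \<comment> \<open>Constants of \<open>'k\<close> embedded into the target ring.\<close>
  define c :: "'k \<Rightarrow> (real \<Rightarrow>\<^sub>0 'k poly)" where "c a = Poly_Mapping.single 0 [:a:]" for a
  have c: "comm_ring_hom c"
  proof unfold_locales
    show "c (a + b) = c a + c b" for a b
      using single_add[of 0 "[:a:]" "[:b:]"] by (simp add: c_def)
  qed (simp_all add: c_def mult_single mult.commute flip: one_pCons)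
  define ev where "ev = poly_eval c (\<lambda>(i, j). y j i)"
  interpret ev: comm_ring_hom ev unfolding ev_def by (rule comm_ring_hom_poly_eval[OF c])
  define K where "K = {p \<in> carrier (poly_ring (gen_vars m n)). ev p = 0}"
  have "ideal K (poly_ring (gen_vars m n))"
    by (rule ideal_poly_ringI)
      (auto simp: K_def carrier_poly_ring ev.hom_add ev.hom_mult
        dest: poly_mult_closed[THEN subsetD, rotated -1] poly_add_closed[THEN subsetD, rotated -1])
  moreover have "minors m \<Delta> \<subseteq> K"
  proof
    fix p :: "(nat \<times> nat, 'k) mpoly" assume "p \<in> minors m \<Delta>"
    then obtain B where B: "B \<in> \<Delta>" "p = minor m B" by (auto simp: minors_def)
    then obtain T where T: "T \<in> \<T>" "B \<subseteq> T" by (auto simp: \<T>(2) clique_def)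
    define L where "L = sorted_list_of_set B"
    have "B \<subseteq> {1..n}" "card B = m" using \<Delta> B by (auto simp: pure_hypergraph_def)
    then have L: "set L = B" "length L = m" using finite_subset[of B "{1..n}"] by (auto simp: L_def)
    define A where "A = mat m m (\<lambda>(i, j). y (L ! j) (Suc i))"
    have "ev p = det (map_mat ev (mat m m (\<lambda>(i, j). X_entry (Suc i) (L ! j))))"
      by (simp add: B(2) minor_def L_def)
    also have "map_mat ev (mat m m (\<lambda>(i, j). X_entry (Suc i) (L ! j))) = A"
      by (rule eq_matI) (simp_all add: A_def ev_def poly_eval_X_entry[OF c])
    also have "det A = 0"
    proof -
      define u where "u i = (if Suc i \<in> I T then Poly_Mapping.single (v T (Suc i)) (1 :: 'k poly) else 0)" for i
      obtain h where h: "h < m" "Suc h \<in> I T" using I[OF T(1)]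
        by (metis One_nat_def Suc_le_eq Suc_pred all_not_in_conv atLeastAtMost_iff less_eq_Suc_le subsetD)
      show ?thesis
      proof (rule det_eq_0_if_left_kernel[of A m u h])
        fix j assume j: "j < m"
        have "(\<Sum>i<m. u i * A $$ (i, j)) =
            (\<Sum>i<m. if Suc i \<in> I T then Poly_Mapping.single (v T (Suc i)) 1 * y (L ! j) (Suc i) else 0)"
          using j by (intro sum.cong) (auto simp: u_def A_def)
        also have "\<dots> = (\<Sum>i\<in>{1..m}. if i \<in> I T then Poly_Mapping.single (v T i) 1 * y (L ! j) i else 0)"
          by (rule sum.reindex_cong[of Suc, symmetric])
            (auto simp: image_Suc_lessThan)
        also have "\<dots> = (\<Sum>i\<in>I T. Poly_Mapping.single (v T i) 1 * y (L ! j) i)"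
          using I[OF T(1)] by (intro sum.mono_neutral_cong_right) auto
        also have "\<dots> = 0" using yz(3)[OF T(1)] T(2) L j nth_mem by blast
        finally show "(\<Sum>i<m. u i * A $$ (i, j)) = 0" .
      next
        show "u h * Poly_Mapping.single (- v T (Suc h)) 1 = 1" using h by (simp add: u_def mult_single)
      qed (use h in \<open>auto simp: A_def\<close>)
    qed
    finally show "p \<in> K" using J_ideal_facts(1)[OF \<Delta>] \<open>p \<in> minors m \<Delta>\<close> by (auto simp: K_def)
  qed
  ultimately have "f \<in> K" using f(1) genideal_minimal_poly_ring unfolding J_ideal_def by blast
  then have "ev f = 0" by (simp add: K_def)
  have lead: "leading (weight \<omega> s) (monom_eval (\<lambda>(i, j). z j i) s) (monom_eval (\<lambda>(i, j). y j i) s)" for s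
    by (rule leading_monom_eval) (auto simp: yz(1))
  have scalar: "Poly_Mapping.lookup (c a * p) d = [:a:] * Poly_Mapping.lookup p d" for a p d
    using lookup_single_times[of 0 "[:a:]" p d] by (simp add: c_def)
  have "Poly_Mapping.lookup (ev f) (weight \<omega> w) = (\<Sum>s\<in>Poly_Mapping.keys f.
      [:Poly_Mapping.lookup f s:] * Poly_Mapping.lookup (monom_eval (\<lambda>(i, j). y j i) s) (weight \<omega> w))"
    by (simp add: ev_def poly_eval_def lookup_sum scalar)
  also have "\<dots> = (\<Sum>s\<in>Poly_Mapping.keys f. if s = w then
      [:Poly_Mapping.lookup f w:] * monom_eval (\<lambda>(i, j). z j i) w else 0)"
  proof (rule sum.cong)
    fix s assume s: "s \<in> Poly_Mapping.keys f"
    have "Poly_Mapping.lookup (monom_eval (\<lambda>(i, j). y j i) s) (weight \<omega> w) = 0" if "s \<noteq> w"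
      using lead[of s] heaviest[OF s that] unfolding leading_def by (meson in_keys_iff not_le)
    then show "[:Poly_Mapping.lookup f s:] * Poly_Mapping.lookup (monom_eval (\<lambda>(i, j). y j i) s) (weight \<omega> w) =
        (if s = w then [:Poly_Mapping.lookup f w:] * monom_eval (\<lambda>(i, j). z j i) w else 0)"
      using lead[of w] by (auto simp: leading_def)
  qed simp
  also have "\<dots> = [:Poly_Mapping.lookup f w:] * monom_eval (\<lambda>(i, j). z j i) w" using f(2) by simp
  finally have "[:Poly_Mapping.lookup f w:] * monom_eval (\<lambda>(i, j). z j i) w = 0" using \<open>ev f = 0\<close> by simp
  moreover have "monom_eval (\<lambda>(i, j). z j i) w \<noteq> 0"
    unfolding monom_eval_def using yz(2) by (auto simp: prod_zero_iff)
  ultimately show False using f(2) by (simp add: in_keys_iff)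
qed

text \<open>
  Suppose that \<open>w\<close>, the leading monomial of \<open>f\<close>, is divisible by no leading monomial of a minor.
  Represent the order by a weight and apply the tropical alternative in every clique to the cells
  of \<open>w\<close>. A row shift under which every row has a strictly maximal cell of \<open>w\<close> exhibits these cells
  as the heaviest matching of a minor of \<open>\<Delta>\<close>, whose leading monomial then divides \<open>w\<close>. So the other
  alternative holds in each clique, and \<open>f\<close> cannot lie in the ideal.
\<close>

lemma clique_minors_groebner_basis:
  assumes m: "2 \<le> m" and \<Delta>: "pure_hypergraph m n \<Delta>"
    and \<T>: "\<And>T. T \<in> \<T> \<Longrightarrow> T \<subseteq> {1..n}" "disjoint \<T>" "\<Delta> = (\<Union>T \<in> \<T>. clique m T)"
    and r: "term_order (gen_vars m n) r"
  shows "groebner_basis (gen_vars m n) r (minors m \<Delta> :: (nat \<times> nat, 'k::field) mpoly set) (J_ideal m n \<Delta>)"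
  unfolding groebner_minors_iff[OF r \<Delta>]
proof (intro ballI impI, rule ccontr)
  fix f :: "(nat \<times> nat, 'k) mpoly"
  assume f: "f \<in> J_ideal m n \<Delta>" "f \<noteq> 0"
  define w where "w = lead_monom r f"
  define M :: "nat set \<Rightarrow> (nat \<times> nat, 'k) mpoly" where "M = minor m"
  assume "\<not> (\<exists>B \<in> \<Delta>. monom_dvd (lead_monom r (minor m B :: (nat \<times> nat, 'k) mpoly)) (lead_monom r f))"
  then have nodvd: "\<not> monom_dvd (lead_monom r (M B)) w" if "B \<in> \<Delta>" for B using that by (auto simp: M_def w_def)
  have finB: "finite B" "card B = m" if "B \<in> \<Delta>" for B
    using that \<Delta> by (auto simp: pure_hypergraph_def intro: finite_subset)
  have car: "f \<in> carrier (poly_ring (gen_vars m n))" "B \<in> \<Delta> \<Longrightarrow> M B \<in> carrier (poly_ring (gen_vars m n))" for B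
    using J_ideal_facts(1,4)[OF \<Delta>, where 'k='k] f(1) by (auto simp: M_def minors_def)
  have M0: "M B \<noteq> 0" if "B \<in> \<Delta>" for B unfolding M_def using finB[OF that] by (rule minor_nonzero)
  define \<F> where "\<F> = insert f (M ` \<Delta>)"
  have \<F>: "p \<in> carrier (poly_ring (gen_vars m n))" "p \<noteq> 0" if "p \<in> \<F>" for p
    using that car M0 f(2) by (auto simp: \<F>_def)
  \<comment> \<open>The comparisons that the weight has to respect: those made inside \<open>f\<close> and inside the minors.\<close>
  define S where "S = (\<Union>p \<in> \<F>. (\<lambda>s. (s, lead_monom r p)) ` (Poly_Mapping.keys p - {lead_monom r p}))"
  have finV: "finite (gen_vars m n)" by (simp add: gen_vars_def)
  have "finite S" using J_ideal_facts(2)[OF \<Delta>] by (simp add: S_def \<F>_def)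
  moreover have "s \<in> monoms (gen_vars m n) \<and> t \<in> monoms (gen_vars m n) \<and> s \<noteq> t \<and> (s, t) \<in> r" if st: "(s, t) \<in> S" for s t
  proof -
    obtain p where p: "p \<in> \<F>" "s \<in> Poly_Mapping.keys p" "s \<noteq> t" "t = lead_monom r p"
      using st by (auto simp: S_def)
    then show ?thesis using lead_monom_in_keys[OF r \<F>[OF p(1)]] \<F>(1)[OF p(1)] by (auto simp: carrier_poly_ring)
  qed
  ultimately obtain \<omega> where \<omega>: "\<And>s t. (s, t) \<in> S \<Longrightarrow> weight \<omega> s < weight \<omega> t"
    using term_order_weight[OF finV r] by metis
  have heavy: "weight \<omega> s < weight \<omega> (lead_monom r p)"
    if "p \<in> \<F>" "s \<in> Poly_Mapping.keys p" "s \<noteq> lead_monom r p" for p s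
    using \<omega> that by (auto simp: S_def)
  define blocked where "blocked T I v \<longleftrightarrow> I \<subseteq> {1..m} \<and> I \<noteq> {} \<and>
      (\<forall>j \<in> T. \<forall>i \<in> I. (i, j) \<in> Poly_Mapping.keys w \<longrightarrow>
        (\<exists>k \<in> I - {i}. v i + \<omega> (i, j) \<le> v k + \<omega> (k, j)))" for T I v
  have "\<exists>I v. blocked T I v" if T: "T \<in> \<T>" for T
  proof (rule tropical_alternative[of "{1..m}" T "\<lambda>i j. (i, j) \<in> Poly_Mapping.keys w" "\<lambda>i j. \<omega> (i, j)"])
    show "finite T" using \<T>(1)[OF T] finite_subset by blast
    show "{1..m} - {i} \<noteq> {}" for i
    proof -
      have "(if i = 1 then 2 else 1) \<in> {1..m} - {i}" using m by auto
      then show ?thesis by blast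
    qed
  next
    fix v assume "\<forall>i \<in> {1..m}. \<exists>j \<in> T. (i, j) \<in> Poly_Mapping.keys w \<and>
      (\<forall>k \<in> {1..m} - {i}. v k + \<omega> (k, j) < v i + \<omega> (i, j))"
    then have "\<forall>i \<in> {1..m}. \<exists>j. j \<in> T \<and> (i, j) \<in> Poly_Mapping.keys w \<and>
      (\<forall>k \<in> {1..m} - {i}. v k + \<omega> (k, j) < v i + \<omega> (i, j))" by blast
    from bchoice[OF this] obtain b where "\<forall>i \<in> {1..m}. b i \<in> T \<and> (i, b i) \<in> Poly_Mapping.keys w \<and>
      (\<forall>k \<in> {1..m} - {i}. v k + \<omega> (k, b i) < v i + \<omega> (i, b i))" by blast
    then have b: "\<And>i. i \<in> {1..m} \<Longrightarrow> b i \<in> T" "\<And>i. i \<in> {1..m} \<Longrightarrow> (i, b i) \<in> Poly_Mapping.keys w"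
      "\<And>i k. i \<in> {1..m} \<Longrightarrow> k \<in> {1..m} \<Longrightarrow> k \<noteq> i \<Longrightarrow> v k + \<omega> (k, b i) < v i + \<omega> (i, b i)"
      by blast+
    have inj: "inj_on b {1..m}"
    proof (rule inj_onI, rule ccontr)
      fix i k assume "i \<in> {1..m}" "k \<in> {1..m}" "b i = b k" "i \<noteq> k"
      then show False using b(3)[of i k] b(3)[of k i] by auto
    qed
    define B E where "B = b ` {1..m}" and "E = (\<lambda>i. (i, b i)) ` {1..m}"
    have B: "B \<in> \<Delta>"
    proof -
      have "b ` {1..m} \<subseteq> T" using b(1) by blast
      moreover have "card (b ` {1..m}) = m" using card_image[OF inj] by simp
      ultimately have "B \<in> clique m T" by (simp only: clique_def B_def mem_Collect_eq)
      with T have "B \<in> (\<Union>T \<in> \<T>. clique m T)" by (rule UN_I)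
      then show ?thesis by (simp only: \<T>(3)[symmetric])
    qed
    have "inj_on snd E"
    proof (rule inj_onI)
      fix x y assume "x \<in> E" "y \<in> E" "snd x = snd y"
      then show "x = y" unfolding E_def using inj_onD[OF inj] by force
    qed
    moreover have "inj_on fst E" "fst ` E = {1..m}" "snd ` E = B"
      by (simp_all only: E_def B_def inj_on_def image_image fst_conv snd_conv image_ident) auto
    ultimately have E: "matching {1..m} B E" by (simp only: matching_def bij_betw_def simp_thms)
    have finE: "finite E" by (simp add: E_def)
    have "lead_monom r (M B) \<in> Poly_Mapping.keys (M B)"
      using lead_monom_in_keys(1)[OF r car(2)[OF B] M0[OF B]] .
    then obtain E' where E': "matching {1..m} B E'" "lead_monom r (M B) = sqfree_monom E'"
      unfolding M_def keys_minor(1)[OF finB[OF B]] by auto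
    have finE': "finite E'" using matching_finite[OF finB(1)[OF B] E'(1)] .
    have row: "bij_betw fst E' {1..m}" and col: "bij_betw snd E' B" using E' by (auto simp: matching_def)
    define q where "q j = the_inv_into {1..m} b j" for j
    have q: "q (b i) = i" if "i \<in> {1..m}" for i using that inj by (simp add: q_def the_inv_into_f_f)
    \<comment> \<open>A row shift changes the weights of all matchings by the same amount, and after the shift \<open>E\<close>
      takes the maximum of every column.\<close>
    have "weight \<omega> (lead_monom r (M B)) + (\<Sum>i\<in>{1..m}. v i) = (\<Sum>(i, j)\<in>E'. v i + \<omega> (i, j))"
      using sum.reindex_bij_betw[OF row, of v] finE'
      by (simp add: E'(2) weight_sqfree_monom case_prod_unfold sum.distrib)
    also have "\<dots> \<le> (\<Sum>(i, j)\<in>E'. v (q j) + \<omega> (q j, j))"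
    proof (intro sum_mono, clarify)
      fix i j assume "(i, j) \<in> E'"
      then have "i \<in> {1..m}" "j \<in> B" using row col by (force simp: bij_betw_def)+
      then obtain k where "k \<in> {1..m}" "j = b k" by (auto simp: B_def)
      then show "v i + \<omega> (i, j) \<le> v (q j) + \<omega> (q j, j)"
        using b(3)[of k i] q[of k] \<open>i \<in> {1..m}\<close> by (cases "i = k") auto
    qed
    also have "\<dots> = (\<Sum>j\<in>B. v (q j) + \<omega> (q j, j))"
      using sum.reindex_bij_betw[OF col, of "\<lambda>j. v (q j) + \<omega> (q j, j)"] by (simp add: case_prod_unfold)
    also have "\<dots> = (\<Sum>i\<in>{1..m}. v i + \<omega> (i, b i))"
      unfolding B_def by (subst sum.reindex[OF inj], rule sum.cong) (simp_all only: o_def q)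
    also have "\<dots> = weight \<omega> (sqfree_monom E) + (\<Sum>i\<in>{1..m}. v i)"
      unfolding weight_sqfree_monom[OF finE] by (simp add: E_def sum.reindex inj_on_def sum.distrib)
    finally have "weight \<omega> (lead_monom r (M B)) \<le> weight \<omega> (sqfree_monom E)" by simp
    moreover have "M B \<in> \<F>" using B by (simp add: \<F>_def)
    moreover have "sqfree_monom E \<in> Poly_Mapping.keys (M B)"
      unfolding M_def keys_minor(1)[OF finB[OF B]] using E by blast
    ultimately have "lead_monom r (M B) = sqfree_monom E" using heavy by force
    then have "monom_dvd (lead_monom r (M B)) w" using b(2) finE by (auto simp: sqfree_monom_dvd_iff E_def)
    then show ?thesis using nodvd[OF B] by blast
  next
    fix I v assume "I \<subseteq> {1..m}" "I \<noteq> {}" "\<forall>j \<in> T. \<forall>i \<in> I. (i, j) \<in> Poly_Mapping.keys w \<longrightarrow>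
      (\<exists>k \<in> I - {i}. v i + \<omega> (i, j) \<le> v k + \<omega> (k, j))"
    then have "blocked T I v" by (simp add: blocked_def)
    then show ?thesis by blast
  qed (use m in auto)
  then obtain I v where "\<And>T. T \<in> \<T> \<Longrightarrow> blocked T (I T) (v T)" by metis
  then have Iv: "\<And>T. T \<in> \<T> \<Longrightarrow> I T \<subseteq> {1..m} \<and> I T \<noteq> {}"
    "\<And>T j i. T \<in> \<T> \<Longrightarrow> j \<in> T \<Longrightarrow> i \<in> I T \<Longrightarrow> (i, j) \<in> Poly_Mapping.keys w \<Longrightarrow>
      \<exists>k \<in> I T - {i}. v T i + \<omega> (i, j) \<le> v T k + \<omega> (k, j)"
    unfolding blocked_def by blast+
  show False
  proof (rule no_strictly_heaviest_monomial[OF \<Delta> \<T>(2,3) f(1), of w \<omega> I v])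
    show "w \<in> Poly_Mapping.keys f" unfolding w_def by (rule lead_monom_in_keys(1)[OF r car(1) f(2)])
    show "weight \<omega> s < weight \<omega> w" if "s \<in> Poly_Mapping.keys f" "s \<noteq> w" for s
      using heavy[of f s] that by (simp add: w_def \<F>_def)
  qed (use Iv in blast)+
qed

section \<open>Term orders defined by weights\<close>

text \<open>
  Ties between monomials of the same weight are broken by the lexicographic order.
\<close>

definition weight_order :: "('x::linorder) set \<Rightarrow> ('x \<Rightarrow> real) \<Rightarrow> 'x monom rel" where
  "weight_order V \<omega> = {(s, t). s \<in> monoms V \<and> t \<in> monoms V \<and>
     (weight \<omega> s < weight \<omega> t \<or> weight \<omega> s = weight \<omega> t \<and> s \<le> t)}"

lemma zero_le_monom: "0 \<le> (s :: 'x::linorder monom)"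
proof -
  have "\<not> s < 0"
    by transfer (auto simp: less_fun_def)
  then show ?thesis by simp
qed

lemma term_order_weight_order:
  assumes "\<And>x. \<omega> x \<ge> 0"
  shows "term_order V (weight_order V \<omega>)"
proof -
  have nonneg: "weight \<omega> s \<ge> 0" for s unfolding weight_def using assms by (simp add: sum_nonneg)
  have zero: "weight \<omega> 0 = 0" by (simp add: weight_def)
  have "linear_order_on (monoms V) (weight_order V \<omega>)"
    unfolding order_on_defs
    by (auto simp: weight_order_def refl_on_def trans_def antisym_def total_on_def)
  moreover have "(0, s) \<in> weight_order V \<omega>" if "s \<in> monoms V" for s
    using that nonneg[of s] zero_le_monom[of s] by (auto simp: weight_order_def zero)
  moreover have "(s + u, t + u) \<in> weight_order V \<omega>"
    if "u \<in> monoms V" "(s, t) \<in> weight_order V \<omega>" for s t u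
    using that by (auto simp: weight_order_def weight_add monoms_add add_right_mono)
  ultimately show ?thesis by (simp add: term_order_def)
qed

text \<open>
  The form in which the universal Groebner property is contradicted below: in some monomial of
  maximal weight of \<open>f\<close> one finds a heaviest matching of a minor of \<open>\<Delta>\<close>.
\<close>

lemma universal_groebner_weight:
  fixes f :: "(nat \<times> nat, 'k::field) mpoly"
  assumes U: "universal_groebner_basis (gen_vars m n) (minors m \<Delta> :: (nat \<times> nat, 'k) mpoly set) (J_ideal m n \<Delta>)"
    and \<Delta>: "pure_hypergraph m n \<Delta>" and \<omega>: "\<And>x. \<omega> x \<ge> 0"
    and f: "f \<in> J_ideal m n \<Delta>" "f \<noteq> 0"
  obtains u B F where "u \<in> Poly_Mapping.keys f" "\<And>s. s \<in> Poly_Mapping.keys f \<Longrightarrow> weight \<omega> s \<le> weight \<omega> u"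
    "B \<in> \<Delta>" "matching {1..m} B F" "F \<subseteq> Poly_Mapping.keys u"
    "\<And>G. matching {1..m} B G \<Longrightarrow> weight \<omega> (sqfree_monom G) \<le> weight \<omega> (sqfree_monom F)"
proof -
  define r where "r = weight_order (gen_vars m n) \<omega>"
  have r: "term_order (gen_vars m n) r" unfolding r_def by (rule term_order_weight_order[OF \<omega>])
  have le: "weight \<omega> s \<le> weight \<omega> t" if "(s, t) \<in> r" for s t using that by (auto simp: r_def weight_order_def)
  have "groebner_basis (gen_vars m n) r (minors m \<Delta> :: (nat \<times> nat, 'k) mpoly set) (J_ideal m n \<Delta>)"
    using U r by (simp add: universal_groebner_basis_def)
  then obtain B where B: "B \<in> \<Delta>" "monom_dvd (lead_monom r (minor m B :: (nat \<times> nat, 'k) mpoly)) (lead_monom r f)"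
    using f unfolding groebner_minors_iff[OF r \<Delta>] by blast
  have B': "finite B" "card B = m" using B(1) \<Delta> by (auto simp: pure_hypergraph_def intro: finite_subset)
  have fcar: "f \<in> carrier (poly_ring (gen_vars m n))" using f(1) J_ideal_facts(4)[OF \<Delta>, where 'k='k] by blast
  have mcar: "(minor m B :: (nat \<times> nat, 'k) mpoly) \<in> carrier (poly_ring (gen_vars m n))"
    using J_ideal_facts(1)[OF \<Delta>, where 'k='k] B(1) by (auto simp: minors_def)
  note leadf = lead_monom_in_keys[OF r fcar f(2)]
  note leadm = lead_monom_in_keys[OF r mcar minor_nonzero[OF B']]
  obtain F where F: "matching {1..m} B F" "lead_monom r (minor m B :: (nat \<times> nat, 'k) mpoly) = sqfree_monom F"
    using leadm(1) unfolding keys_minor(1)[OF B'] by auto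
  have finF: "finite F" using matching_finite[OF B'(1) F(1)] .
  show thesis
  proof (rule that[of "lead_monom r f" B F])
    show "F \<subseteq> Poly_Mapping.keys (lead_monom r f)" using B(2) by (simp add: F(2) sqfree_monom_dvd_iff[OF finF])
    show "weight \<omega> (sqfree_monom G) \<le> weight \<omega> (sqfree_monom F)" if "matching {1..m} B G" for G
      using leadm(2)[of "sqfree_monom G"] le that by (auto simp: F(2) keys_minor(1)[OF B'])
  qed (use leadf le B(1) F(1) in auto)
qed

section \<open>Perfect matchings as graphs of bijections\<close>

definition placement :: "('c \<Rightarrow> 'r) \<Rightarrow> 'c set \<Rightarrow> ('r \<times> 'c) set" where
  "placement f B = (\<lambda>j. (f j, j)) ` B"

lemma in_placement [simp]: "(i, j) \<in> placement f B \<longleftrightarrow> j \<in> B \<and> i = f j"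
  by (auto simp: placement_def)

lemma finite_placement [simp]: "finite B \<Longrightarrow> finite (placement f B)"
  by (simp add: placement_def)

lemma matching_iff_placement: "matching R B F \<longleftrightarrow> (\<exists>f. bij_betw f B R \<and> F = placement f B)"
proof
  assume F: "matching R B F"
  then have row: "bij_betw fst F R" and col: "bij_betw snd F B" by (auto simp: matching_def)
  let ?f = "fst \<circ> the_inv_into F snd"
  have "F = placement ?f B"
  proof -
    have "x = (fst (the_inv_into F snd (snd x)), snd x)" if "x \<in> F" for x
      using the_inv_into_f_f[of snd F x] col that by (simp add: bij_betw_def)
    then have "F = (\<lambda>x. (?f (snd x), snd x)) ` F" by (auto simp: image_iff)
    also have "\<dots> = placement ?f (snd ` F)" by (simp add: placement_def image_image)
    finally show ?thesis using col by (simp add: bij_betw_def)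
  qed
  moreover have "bij_betw ?f B R" by (rule bij_betw_trans[OF bij_betw_the_inv_into[OF col] row])
  ultimately show "\<exists>f. bij_betw f B R \<and> F = placement f B" by blast
next
  assume "\<exists>f. bij_betw f B R \<and> F = placement f B"
  then show "matching R B F"
    by (auto simp: matching_def placement_def bij_betw_def inj_on_def image_image)
qed

lemma matching_unique_row: "matching R B F \<Longrightarrow> (i, j) \<in> F \<Longrightarrow> (i, j') \<in> F \<Longrightarrow> j = j'"
  by (auto simp: matching_iff_placement bij_betw_def inj_on_def)

lemma matching_ex:
  assumes "finite B" "card B = m" "b \<in> B" "i \<in> {1..m}"
  obtains E where "matching {1..m} B E" "(i, b) \<in> E"
proof -
  obtain f where f: "bij_betw f B {1..m}" using assms(1,2) by (metis card_atLeastAtMost diff_Suc_1 finite_atLeastAtMost finite_same_card_bij)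
  have "i \<in> f ` B" using f assms(4) by (simp only: bij_betw_def)
  then obtain b' where b': "b' \<in> B" "f b' = i" by blast
  have "bij_betw (transpose b b') B B" using assms(3) b'(1) by (intro bij_betw_transpose_iff) simp
  from bij_betw_trans[OF this f] have "matching {1..m} B (placement (f \<circ> transpose b b') B)"
    by (auto simp: matching_iff_placement)
  then show thesis using b' assms(3) by (intro that) auto
qed

section \<open>Edges that differ in one vertex\<close>

text \<open>
  Repeat the first row of the matrix with the columns \<open>U\<close> and expand the vanishing determinant
  along it.
\<close>

lemma minor_relation:
  fixes U :: "nat set"
  assumes U: "finite U" "card U = Suc m" and m: "m \<ge> 1"
  obtains \<epsilon> :: "nat \<Rightarrow> 'k::field" where "\<And>b. \<epsilon> b = 1 \<or> \<epsilon> b = - 1"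
    "(\<Sum>b\<in>U. Poly_Mapping.single (Poly_Mapping.single (1, b) 1) (\<epsilon> b) * minor m (U - {b})) = 0"
proof -
  define L where "L = sorted_list_of_set U"
  have L: "distinct L" "length L = Suc m" "set L = U" using U by (simp_all add: L_def)
  have Lb: "bij_betw ((!) L) {..<Suc m} U" using L bij_betw_nth[OF L(1)] by auto
  define A :: "(nat \<times> nat, 'k) mpoly mat" where
    "A = mat (Suc m) (Suc m) (\<lambda>(i, j). X_entry (if i = 0 then 1 else i) (L ! j))"
  have A: "A \<in> carrier_mat (Suc m) (Suc m)" by (simp add: A_def)
  have "row A 0 = row A 1" using m by (intro eq_vecI) (auto simp: A_def)
  then have "det A = 0" using m by (intro det_identical_rows[OF A, of 0 1]) auto
  have del: "det (mat_delete A 0 j) = minor m (U - {L ! j})" if j: "j < Suc m" for j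
  proof -
    have "sorted_list_of_set (U - {L ! j}) = remove1 (L ! j) L"
      using U(1) by (simp add: L_def sorted_list_of_set_remove)
    also have "L = take j L @ L ! j # drop (Suc j) L" using j L by (simp add: id_take_nth_drop)
    then have "remove1 (L ! j) L = take j L @ drop (Suc j) L"
      using L(1) by (metis distinct_append disjoint_iff list.set_intros(1) remove1.simps(2) remove1_append)
    finally have S: "sorted_list_of_set (U - {L ! j}) = take j L @ drop (Suc j) L" .
    have "mat_delete A 0 j = mat m m (\<lambda>(i, k). X_entry (Suc i) (sorted_list_of_set (U - {L ! j}) ! k))"
      unfolding S using j L by (intro eq_matI) (auto simp: mat_delete_def A_def nth_append)
    then show ?thesis by (simp add: minor_def)
  qed
  define q where "q = the_inv_into {..<Suc m} ((!) L)"
  have q: "q (L ! j) = j" if "j < Suc m" for j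
    unfolding q_def using Lb that by (intro the_inv_into_f_f) (auto simp: bij_betw_def)
  define \<epsilon> where "\<epsilon> b = ((- 1) ^ q b :: 'k)" for b
  have single_sign: "Poly_Mapping.single s ((- 1) ^ k :: 'k) = Poly_Mapping.single s 1 * (- 1) ^ k" for s :: "(nat \<times> nat) monom" and k
    by (cases "even k") (auto simp: single_uminus)
  have "0 = (\<Sum>j<Suc m. A $$ (0, j) * cofactor A 0 j)"
    using laplace_expansion_row[OF A, of 0] \<open>det A = 0\<close> by simp
  also have "\<dots> = (\<Sum>j<Suc m. Poly_Mapping.single (Poly_Mapping.single (1, L ! j) 1) (\<epsilon> (L ! j)) * minor m (U - {L ! j}))"
  proof (rule sum.cong)
    fix j assume "j \<in> {..<Suc m}"
    then have j: "j < Suc m" by simp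
    have "A $$ (0, j) = msingle (Poly_Mapping.single (1, L ! j) 1)" using j by (simp add: A_def X_entry_def)
    then show "A $$ (0, j) * cofactor A 0 j =
        Poly_Mapping.single (Poly_Mapping.single (1, L ! j) 1) (\<epsilon> (L ! j)) * minor m (U - {L ! j})"
      using j by (simp add: cofactor_def del \<epsilon>_def q single_sign mult.assoc)
  qed simp
  also have "\<dots> = (\<Sum>b\<in>U. Poly_Mapping.single (Poly_Mapping.single (1, b) 1) (\<epsilon> b) * minor m (U - {b}))"
    by (rule sum.reindex_bij_betw[OF Lb])
  finally show thesis by (intro that[of \<epsilon>]) (auto simp: \<epsilon>_def minus_one_power_iff)
qed

lemma card_Suc_remove: "finite U \<Longrightarrow> card U = Suc m \<Longrightarrow> B \<subseteq> U \<Longrightarrow> card B = m \<Longrightarrow> \<exists>b \<in> U. B = U - {b}"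
proof -
  assume a: "finite U" "card U = Suc m" "B \<subseteq> U" "card B = m"
  then have "card (U - B) = 1" by (simp add: card_Diff_subset finite_subset)
  then obtain b where "U - B = {b}" by (auto simp: card_1_singleton_iff)
  then show ?thesis using a(3) by (intro bexI[of _ b]) auto
qed

text \<open>
  Let \<open>U = B1 \<union> B2\<close> and let \<open>P\<close> be the set of \<open>b\<close> with \<open>U - {b}\<close> in \<open>\<Delta>\<close>. If some \<open>U - {q}\<close> is
  missing, the part of the relation above that is indexed by \<open>U - P\<close> is a nonzero element \<open>e\<close> of the
  ideal. Each of its monomials contains a cell \<open>(1, b)\<close> with \<open>b\<close> outside \<open>P\<close>, and no other cell of
  column \<open>b\<close>. A leading matching inside it belongs to a minor \<open>U - {j}\<close> with \<open>j \<in> P\<close>, so it uses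
  column \<open>b\<close> and puts the first row there. Weighting the cells \<open>(1, p)\<close> with \<open>p \<in> P\<close>, however,
  forces the leading matching of such a minor to put the first row in a column of \<open>P\<close>; as \<open>P\<close> has
  two elements, one remains after deleting \<open>j\<close>.
\<close>

lemma adjacent_edges:
  assumes ugb: "universal_groebner_basis (gen_vars m n) (minors m \<Delta> :: (nat \<times> nat, 'k::field) mpoly set) (J_ideal m n \<Delta>)"
    and \<Delta>: "pure_hypergraph m n \<Delta>" and m: "m \<ge> 1"
    and B: "B1 \<in> \<Delta>" "B2 \<in> \<Delta>" "card (B1 \<union> B2) = Suc m" "B \<subseteq> B1 \<union> B2" "card B = m"
  shows "B \<in> \<Delta>"
proof (rule ccontr)
  assume "B \<notin> \<Delta>"
  define U where "U = B1 \<union> B2"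
  have pure: "D \<subseteq> {1..n}" "finite D" "card D = m" if "D \<in> \<Delta>" for D
    using that \<Delta> by (auto simp: pure_hypergraph_def intro: finite_subset)
  have U: "finite U" "card U = Suc m" "U \<subseteq> {1..n}" using B pure by (auto simp: U_def)
  have cardU: "finite (U - {b})" "card (U - {b}) = m" if "b \<in> U" for b using U that by auto
  define P where "P = {b \<in> U. U - {b} \<in> \<Delta>}"
  have sub: "B1 \<subseteq> U" "B2 \<subseteq> U" "B \<subseteq> U" using B(4) by (auto simp: U_def)
  obtain q where q: "q \<in> U" "B = U - {q}" using card_Suc_remove[OF U(1,2) sub(3) B(5)] by blast
  obtain p1 where p1: "p1 \<in> U" "B1 = U - {p1}" using card_Suc_remove[OF U(1,2) sub(1) pure(3)[OF B(1)]] by blast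
  obtain p2 where p2: "p2 \<in> U" "B2 = U - {p2}" using card_Suc_remove[OF U(1,2) sub(2) pure(3)[OF B(2)]] by blast
  have P: "p1 \<in> P" "p2 \<in> P" "p1 \<noteq> p2" "q \<in> U - P" "P \<subseteq> U"
  proof -
    show "p1 \<in> P" "p2 \<in> P" using p1 p2 B(1,2) unfolding P_def by blast+
    show "q \<in> U - P" using q \<open>B \<notin> \<Delta>\<close> unfolding P_def by blast
    show "P \<subseteq> U" unfolding P_def by blast
    have "p1 \<in> B1 \<or> p1 \<in> B2" using p1(1) unfolding U_def by blast
    moreover have "p1 \<notin> B1" by (subst p1(2)) simp
    moreover have "p2 \<notin> B2" by (subst p2(2)) simp
    ultimately show "p1 \<noteq> p2" by blast
  qed
  let ?x = "\<lambda>b. Poly_Mapping.single (1, b) 1 :: (nat \<times> nat) monom"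
  obtain \<epsilon> :: "nat \<Rightarrow> 'k" where \<epsilon>: "\<And>b. \<epsilon> b = 1 \<or> \<epsilon> b = - 1"
    "(\<Sum>b\<in>U. Poly_Mapping.single (?x b) (\<epsilon> b) * minor m (U - {b})) = 0"
    using minor_relation[OF U(1,2) m] by blast
  have \<epsilon>0: "\<epsilon> b \<noteq> 0" for b using \<epsilon>(1)[of b] by auto
  define t where "t b = Poly_Mapping.single (?x b) (\<epsilon> b) * minor m (U - {b})" for b
  define e where "e = (\<Sum>b\<in>U - P. t b)"
  have "e = - (\<Sum>b\<in>P. t b)"
    using \<epsilon>(2) sum.subset_diff[OF P(5) U(1), of t] by (simp add: e_def t_def eq_neg_iff_add_eq_0)
  moreover have "(\<Sum>b\<in>P. t b) \<in> J_ideal m n \<Delta>"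
    unfolding J_ideal_def
  proof (rule genideal_poly_ring(7)[OF J_ideal_facts(1)[OF \<Delta>]])
    fix b assume b: "b \<in> P"
    then have "(1, b) \<in> gen_vars m n" using U(3) m by (auto simp: gen_vars_def P_def)
    then show "t b \<in> Idl\<^bsub>poly_ring (gen_vars m n)\<^esub> minors m \<Delta>"
      unfolding t_def using b genideal_poly_ring(1)[OF J_ideal_facts(1)[OF \<Delta>]]
      by (intro genideal_poly_ring(5)[OF J_ideal_facts(1)[OF \<Delta>]])
        (auto simp: carrier_poly_ring monoms_def P_def minors_def)
  qed
  ultimately have eJ: "e \<in> J_ideal m n \<Delta>"
    using genideal_poly_ring(3,6)[OF J_ideal_facts(1)[OF \<Delta>, where 'k='k]] unfolding J_ideal_def
    by (metis diff_0)
  have keys_t: "\<exists>E. matching {1..m} (U - {b}) E \<and> s = ?x b + sqfree_monom E" if "b \<in> U" "s \<in> Poly_Mapping.keys (t b)" for b s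
    using that cardU[OF that(1)] by (auto simp: t_def keys_single_times[OF \<epsilon>0] keys_minor)
  have "e \<noteq> 0"
  proof -
    obtain E where E: "matching {1..m} (U - {q}) E" "(1, p1) \<in> E"
      using matching_ex[OF cardU[OF q(1)], of p1 1] P m by auto
    have finE: "finite E" using matching_finite[OF _ E(1)] U(1) by simp
    let ?s = "?x q + sqfree_monom E"
    have "Poly_Mapping.lookup (t b) ?s = 0" if b: "b \<in> U - P" "b \<noteq> q" for b
    proof (rule ccontr)
      assume "Poly_Mapping.lookup (t b) ?s \<noteq> 0"
      then obtain E' where "?s = ?x b + sqfree_monom E'" using keys_t[of b ?s] b by (auto simp: in_keys_iff)
      then have "Poly_Mapping.lookup ?s (1, b) > 0" by (simp add: lookup_add)
      then have "(1, b) \<in> E" using b(2) finE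
        by (auto simp: lookup_add lookup_single when_def lookup_sqfree_monom split: if_splits)
      then have "b = p1" using matching_unique_row[OF E(1)] E(2) by blast
      then show False using b P by auto
    qed
    then have "Poly_Mapping.lookup e ?s = (\<Sum>b\<in>U - P. if b = q then Poly_Mapping.lookup (t q) ?s else 0)"
      unfolding e_def lookup_sum by (intro sum.cong) auto
    also have "\<dots> = Poly_Mapping.lookup (t q) ?s" using U(1) P(4) by simp
    also have "\<dots> = \<epsilon> q * Poly_Mapping.lookup (minor m (U - {q})) (sqfree_monom E)"
      unfolding t_def by (rule lookup_single_times)
    also have "\<dots> \<noteq> 0" using keys_minor(2)[OF cardU[OF q(1)] E(1), where 'k='k] \<epsilon>0[of q] by auto
    finally show ?thesis by auto
  qed
  define \<omega> :: "nat \<times> nat \<Rightarrow> real" where "\<omega> x = (if fst x = 1 \<and> snd x \<in> P then 1 else 0)" for x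
  have \<omega>0: "\<omega> x \<ge> 0" for x by (simp add: \<omega>_def)
  obtain u B' F where u: "u \<in> Poly_Mapping.keys e"
    "\<And>s. s \<in> Poly_Mapping.keys e \<Longrightarrow> weight \<omega> s \<le> weight \<omega> u" and B': "B' \<in> \<Delta>" and F: "matching {1..m} B' F" "F \<subseteq> Poly_Mapping.keys u"
    "\<And>G. matching {1..m} B' G \<Longrightarrow> weight \<omega> (sqfree_monom G) \<le> weight \<omega> (sqfree_monom F)"
    by (rule universal_groebner_weight[where \<omega> = \<omega>, OF ugb \<Delta> \<omega>0 eJ \<open>e \<noteq> 0\<close>]) (rule that)
  obtain b where b: "b \<in> U - P" "u \<in> Poly_Mapping.keys (t b)"
    using u(1) keys_sum[of t "U - P"] unfolding e_def by blast
  obtain E where E: "matching {1..m} (U - {b}) E" "u = ?x b + sqfree_monom E" using keys_t[of b u] b by blast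
  have finE: "finite E" using matching_finite[OF _ E(1)] U(1) by simp
  have keys_u: "Poly_Mapping.keys u \<subseteq> insert (1, b) E"
    unfolding E(2) using keys_add[of "?x b" "sqfree_monom E"] finE by auto
  have colE: "snd ` E = U - {b}" using E(1) by (simp add: matching_def bij_betw_def)
  have colF: "snd ` F = B'" using F(1) by (simp add: matching_def bij_betw_def)
  have "snd ` F \<subseteq> insert b (snd ` E)" using F(2) keys_u by auto
  then have "B' \<subseteq> U" using colE colF b(1) by auto
  then obtain j where j: "j \<in> U" "B' = U - {j}" using card_Suc_remove[OF U(1,2) _ pure(3)[OF B']] by blast
  have "j \<in> P" using j B' by (simp add: P_def)
  obtain p where p: "p \<in> P" "(1, p) \<in> F"
  proof -
    obtain p' where p': "p' \<in> P" "p' \<in> B'" using P j by (metis Diff_iff empty_iff insert_iff subsetD)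
    obtain G where G: "matching {1..m} B' G" "(1, p') \<in> G"
      using matching_ex[OF pure(2,3)[OF B'] p'(2), of 1] m by auto
    have finG: "finite G" "finite F" using matching_finite[OF pure(2)[OF B']] G(1) F(1) by auto
    have "1 \<le> (\<Sum>x\<in>G. \<omega> x)" using member_le_sum[of "(1, p')" G \<omega>] G(2) finG p'(1) \<omega>0 by (simp add: \<omega>_def)
    also have "\<dots> \<le> (\<Sum>x\<in>F. \<omega> x)" using F(3)[OF G(1)] finG by (simp add: weight_sqfree_monom)
    finally have "(\<Sum>x\<in>F. \<omega> x) \<noteq> 0" by simp
    then obtain x where "x \<in> F" "\<omega> x \<noteq> 0" by (meson sum.neutral)
    then have "snd x \<in> P" "(1, snd x) = x" by (auto simp: \<omega>_def prod_eq_iff split: if_splits)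
    with \<open>x \<in> F\<close> show thesis by (intro that[of "snd x"]) simp_all
  qed
  have "b \<in> B'" using b(1) j \<open>j \<in> P\<close> by auto
  then obtain i where i: "(i, b) \<in> F" using colF by force
  then have "(i, b) \<in> insert (1, b) E" using F(2) keys_u by blast
  moreover have "(i, b) \<notin> E" using colE by force
  ultimately have "i = 1" by simp
  then have "b = p" using matching_unique_row[OF F(1)] i p(2) by blast
  then show False using b(1) p(1) by simp
qed

section \<open>Intersecting edges that differ in several vertices\<close>

text \<open>
  The weight prefers the matching \<open>\<sigma>\<close> and makes the exchange of the rows of \<open>c\<close> and \<open>d\<close> the unique
  second best choice: each column contributes at most \<open>2\<close>, with a bonus of \<open>1\<close> for \<open>(\<sigma> c, c)\<close>, so a
  single cell of weight \<open>0\<close> already costs too much.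
\<close>

lemma swap_second_best:
  fixes \<sigma> \<phi> :: "nat \<Rightarrow> nat" and \<omega> :: "nat \<times> nat \<Rightarrow> real"
  assumes B: "finite B" "card B = m" and \<phi>: "bij_betw \<phi> B {1..m}" and cd: "c \<in> B" "d \<in> B" "c \<noteq> d"
    and sn: "\<sigma> c \<noteq> \<sigma> d"
    and \<omega>: "\<And>i j. j \<in> B \<Longrightarrow> j \<noteq> c \<Longrightarrow> j \<noteq> d \<Longrightarrow> \<omega> (i, j) = (if i = \<sigma> j then 2 else 0)"
      "\<And>i. \<omega> (i, c) = (if i = \<sigma> c then 3 else if i = \<sigma> d then 2 else 0)"
      "\<And>i. \<omega> (i, d) = (if i = \<sigma> c \<or> i = \<sigma> d then 2 else 0)"
  defines "\<tau> \<equiv> \<sigma>(c := \<sigma> d, d := \<sigma> c)"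
  shows "weight \<omega> (sqfree_monom (placement \<sigma> B)) = real (2 * m + 1)"
    and "weight \<omega> (sqfree_monom (placement \<tau> B)) = real (2 * m)"
    and "real (2 * m) \<le> weight \<omega> (sqfree_monom (placement \<phi> B)) \<Longrightarrow>
      placement \<phi> B = placement \<sigma> B \<or> placement \<phi> B = placement \<tau> B"
proof -
  have wt: "weight \<omega> (sqfree_monom (placement \<psi> B)) = (\<Sum>j\<in>B. \<omega> (\<psi> j, j))" for \<psi>
    using B(1) by (simp add: weight_sqfree_monom) (simp add: placement_def sum.reindex inj_on_def)
  have "weight \<omega> (sqfree_monom (placement \<sigma> B)) = (\<Sum>j\<in>B. 2 + (if j = c then 1 else 0))"
    unfolding wt
  proof (rule sum.cong)
    fix j assume "j \<in> B"
    then show "\<omega> (\<sigma> j, j) = 2 + (if j = c then 1 else 0)"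
      using \<omega>(1)[of j "\<sigma> j"] \<omega>(2)[of "\<sigma> c"] \<omega>(3)[of "\<sigma> d"] cd(3) by (cases "j = c"; cases "j = d") auto
  qed simp
  then show "weight \<omega> (sqfree_monom (placement \<sigma> B)) = real (2 * m + 1)" using B cd by (simp add: sum.distrib)
  have "weight \<omega> (sqfree_monom (placement \<tau> B)) = (\<Sum>j\<in>B. 2 :: real)"
    unfolding wt
  proof (rule sum.cong)
    fix j assume "j \<in> B"
    then show "\<omega> (\<tau> j, j) = 2"
      using \<omega>(1)[of j "\<sigma> j"] \<omega>(2)[of "\<sigma> d"] \<omega>(3)[of "\<sigma> c"] cd(3) sn
      by (cases "j = c"; cases "j = d") (auto simp: \<tau>_def)
  qed simp
  then show "weight \<omega> (sqfree_monom (placement \<tau> B)) = real (2 * m)" using B by simp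
  assume ge: "real (2 * m) \<le> weight \<omega> (sqfree_monom (placement \<phi> B))"
  have le: "\<omega> (\<phi> j, j) \<le> 2 + (if j = c then 1 else 0)" if "j \<in> B" for j
    using \<omega>(1)[of j "\<phi> j"] \<omega>(2)[of "\<phi> c"] \<omega>(3)[of "\<phi> d"] that by (cases "j = c"; cases "j = d") auto
  have pos: "\<omega> (\<phi> j, j) \<noteq> 0" if j: "j \<in> B" for j
  proof
    assume "\<omega> (\<phi> j, j) = 0"
    then have "weight \<omega> (sqfree_monom (placement \<phi> B)) = (\<Sum>k\<in>B - {j}. \<omega> (\<phi> k, k))"
      unfolding wt using B(1) j by (simp add: sum.remove)
    also have "\<dots> \<le> (\<Sum>k\<in>B - {j}. 2 + (if k = c then 1 else 0))" using le by (intro sum_mono) auto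
    also have "\<dots> \<le> 2 * real (card (B - {j})) + 1" using B(1) by (simp add: sum.distrib)
    also have "real (card (B - {j})) = real m - 1" using B j card_gt_0_iff[of B] by (auto simp: of_nat_diff)
    finally show False using ge by simp
  qed
  have other: "\<phi> j = \<sigma> j" if "j \<in> B" "j \<noteq> c" "j \<noteq> d" for j
    using pos[OF that(1)] \<omega>(1)[OF that, of "\<phi> j"] by (auto split: if_splits)
  have c: "\<phi> c = \<sigma> c \<or> \<phi> c = \<sigma> d" using pos[OF cd(1)] \<omega>(2)[of "\<phi> c"] by (auto split: if_splits)
  have d: "\<phi> d = \<sigma> c \<or> \<phi> d = \<sigma> d" using pos[OF cd(2)] \<omega>(3)[of "\<phi> d"] by (auto split: if_splits)
  have "\<phi> c \<noteq> \<phi> d" using \<phi> cd by (auto simp: bij_betw_def dest: inj_onD)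
  with c d have "\<phi> c = \<sigma> c \<and> \<phi> d = \<sigma> d \<or> \<phi> c = \<sigma> d \<and> \<phi> d = \<sigma> c" by auto
  then show "placement \<phi> B = placement \<sigma> B \<or> placement \<phi> B = placement \<tau> B"
  proof
    assume "\<phi> c = \<sigma> c \<and> \<phi> d = \<sigma> d"
    then have "\<phi> j = \<sigma> j" if "j \<in> B" for j using other that by metis
    then show ?thesis by (simp add: placement_def)
  next
    assume "\<phi> c = \<sigma> d \<and> \<phi> d = \<sigma> c"
    then have "\<phi> j = \<tau> j" if "j \<in> B" for j using other[of j] that by (auto simp: \<tau>_def)
    then show ?thesis by (simp add: placement_def)
  qed
qed

text \<open>
  The cells of the leading monomial of the S-polynomial used below repeat rows: \<open>c\<close> and \<open>d2\<close> share
  a row, and so do \<open>e1\<close> and \<open>e2\<close>. A matching contained in these cells avoids one column of each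
  such pair.
\<close>

lemma swapped_placement_obstruction:
  assumes F: "matching R B F" "F \<subseteq> placement \<sigma> D2 \<union> placement \<tau> B1"
    and c: "c \<in> B1" "c \<in> B2" and d2: "d2 \<in> D2" "\<tau> c = \<sigma> d2" and D2: "D2 \<subseteq> B2" "D2 \<inter> B1 = {}"
    and e: "e1 \<in> B1" "e2 \<in> D2" "\<tau> e1 = \<sigma> e2"
  shows "B \<subseteq> B1 \<union> D2" "B \<noteq> B2" "\<not> (e1 \<in> B \<and> e2 \<in> B)" "B = B1 \<Longrightarrow> F = placement \<tau> B1"
proof -
  have col: "snd ` F = B" using F(1) by (simp add: matching_def bij_betw_def)
  have in2: "(\<sigma> j, j) \<in> F" if j: "j \<in> B" "j \<in> D2" for j
  proof -
    obtain i where ij: "(i, j) \<in> F" using col j(1) by force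
    then have "i = \<sigma> j" using subsetD[OF F(2) ij] j D2(2) by auto
    with ij show ?thesis by simp
  qed
  have in1: "(\<tau> j, j) \<in> F" if j: "j \<in> B" "j \<in> B1" for j
  proof -
    obtain i where ij: "(i, j) \<in> F" using col j(1) by force
    then have "i = \<tau> j" using subsetD[OF F(2) ij] j D2(2) by auto
    with ij show ?thesis by simp
  qed
  show "B \<subseteq> B1 \<union> D2" using col F(2) by auto
  show "B \<noteq> B2"
  proof
    assume "B = B2"
    then have "(\<sigma> d2, d2) \<in> F" "(\<tau> c, c) \<in> F" using in1[of c] in2[of d2] c d2(1) D2 by blast+
    then have "d2 = c" using matching_unique_row[OF F(1)] d2(2) by metis
    then show False using c d2 D2 by auto
  qed
  show "\<not> (e1 \<in> B \<and> e2 \<in> B)"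
  proof
    assume "e1 \<in> B \<and> e2 \<in> B"
    then have "(\<sigma> e2, e2) \<in> F" "(\<tau> e1, e1) \<in> F" using in1[of e1] in2[of e2] e(1,2) by blast+
    then have "e2 = e1" using matching_unique_row[OF F(1)] e(3) by metis
    then show False using e D2 by auto
  qed
  show "F = placement \<tau> B1" if "B = B1"
  proof
    show "F \<subseteq> placement \<tau> B1"
    proof
      fix x assume x: "x \<in> F"
      then have "snd x \<in> B1" using col that by blast
      then show "x \<in> placement \<tau> B1"
        using subsetD[OF F(2) x] D2(2) by (cases x) auto
    qed
    show "placement \<tau> B1 \<subseteq> F" using in1 that by auto
  qed
qed

text \<open>
  Choose matchings of \<open>B1\<close> and \<open>B2\<close> that agree on \<open>B1 \<inter> B2\<close>, given by one function \<open>\<sigma>\<close>, and the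
  weight of the previous lemma for a column \<open>c\<close> of the intersection and columns \<open>d1\<close>, \<open>d2\<close> in the
  two differences with the same row. The leading terms then have a common factor, and the leading
  monomial of the S-polynomial \<open>g\<close> arises by exchanging the row of \<open>c\<close> with that of \<open>d1\<close> or \<open>d2\<close>. It
  is divisible by the leading monomial of some minor of \<open>\<Delta>\<close>, whose column set \<open>B\<close> can be neither
  \<open>B1\<close> nor \<open>B2\<close>. Since the differences have a second vertex each, \<open>e1\<close> and \<open>e2\<close>, which compete for
  the same row, \<open>B\<close> does not contain the whole symmetric difference either.
\<close>

lemma third_edge:
  assumes ugb: "universal_groebner_basis (gen_vars m n) (minors m \<Delta> :: (nat \<times> nat, 'k::field) mpoly set) (J_ideal m n \<Delta>)"
    and \<Delta>: "pure_hypergraph m n \<Delta>"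
    and B: "B1 \<in> \<Delta>" "B2 \<in> \<Delta>" "B1 \<inter> B2 \<noteq> {}" "card (B1 - B2) \<ge> 2"
  obtains B where "B \<in> \<Delta>" "B \<subseteq> B1 \<union> B2" "B \<noteq> B1" "B \<noteq> B2" "\<not> (B1 - B2) \<union> (B2 - B1) \<subseteq> B"
proof -
  have pure: "D \<subseteq> {1..n}" "finite D" "card D = m" if "D \<in> \<Delta>" for D
    using that \<Delta> by (auto simp: pure_hypergraph_def intro: finite_subset)
  note fin1 = pure(2,3)[OF B(1)] and fin2 = pure(2,3)[OF B(2)]
  define D1 D2 where "D1 = B1 - B2" and "D2 = B2 - B1"
  have finD: "finite D1" "finite D2" using fin1 fin2 by (auto simp: D1_def D2_def)
  have cardD: "card D2 = card D1"
    unfolding D1_def D2_def using fin1 fin2 by (simp add: card_Diff_subset_Int Int_commute)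
  obtain h where h: "bij_betw h D2 D1" using finD cardD finite_same_card_bij by metis
  obtain f where f: "bij_betw f B1 {1..m}" using fin1 by (metis card_atLeastAtMost diff_Suc_1 finite_atLeastAtMost finite_same_card_bij)
  \<comment> \<open>Columns of \<open>B2\<close> outside \<open>B1\<close> borrow their rows from \<open>B1\<close> through \<open>h\<close>.\<close>
  define \<sigma> where "\<sigma> j = (if j \<in> B1 then f j else f (h j))" for j
  have \<sigma>1: "bij_betw \<sigma> B1 {1..m}" using f by (simp add: \<sigma>_def cong: bij_betw_cong)
  have \<sigma>h: "\<sigma> j = \<sigma> (h j)" "h j \<in> D1" if "j \<in> D2" for j
    using h that by (auto simp: \<sigma>_def bij_betw_def D1_def D2_def)
  define g where "g j = (if j \<in> B1 then j else h j)" for j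
  have g: "bij_betw g B2 B1"
  proof -
    have "bij_betw g (B1 \<inter> B2) (B1 \<inter> B2)" by (auto simp: g_def bij_betw_def inj_on_def)
    moreover have "bij_betw g D2 D1"
      using h by (rule bij_betw_cong[THEN iffD1, rotated]) (simp add: g_def D2_def)
    ultimately have "bij_betw g (B1 \<inter> B2 \<union> D2) (B1 \<inter> B2 \<union> D1)"
      by (rule bij_betw_combine) (auto simp: D1_def)
    moreover have "B1 \<inter> B2 \<union> D2 = B2" "B1 \<inter> B2 \<union> D1 = B1" by (auto simp: D1_def D2_def)
    ultimately show ?thesis by simp
  qed
  have \<sigma>2: "bij_betw \<sigma> B2 {1..m}"
  proof -
    have "(\<sigma> \<circ> g) j = \<sigma> j" if "j \<in> B2" for j
      using \<sigma>h(1)[of j] that by (cases "j \<in> B1") (simp_all add: g_def D2_def)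
    then show ?thesis using bij_betw_trans[OF g \<sigma>1] bij_betw_cong by blast
  qed
  obtain c where c: "c \<in> B1" "c \<in> B2" using B(3) by blast
  have "card D1 \<ge> 2" using B(4) by (simp add: D1_def)
  then obtain S where "S \<subseteq> D1" "card S = 2" by (rule obtain_subset_with_card_n)
  then obtain d1 e1 where de1: "d1 \<in> D1" "e1 \<in> D1" "d1 \<noteq> e1"
    by (auto simp: card_2_iff)
  obtain d2 e2 where de2: "d2 \<in> D2" "h d2 = d1" "e2 \<in> D2" "h e2 = e1"
    using h de1 unfolding bij_betw_def by blast
  have neq: "d2 \<noteq> e2" "c \<noteq> d1" "c \<noteq> d2" "c \<noteq> e1" "c \<noteq> e2" "d1 \<noteq> d2" "e1 \<noteq> d2" "d1 \<noteq> e2"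
    using de1 de2 c by (auto simp: D1_def D2_def)
  have inB: "d1 \<in> B1" "e1 \<in> B1" "d2 \<in> B2" "e2 \<in> B2" "d1 \<notin> B2" "e1 \<notin> B2" "d2 \<notin> B1" "e2 \<notin> B1"
    using de1 de2 by (auto simp: D1_def D2_def)
  have sd: "\<sigma> d2 = \<sigma> d1" "\<sigma> e2 = \<sigma> e1" using \<sigma>h de2 by auto
  have sc: "\<sigma> c \<noteq> \<sigma> d1" using \<sigma>1 c inB neq by (auto simp: bij_betw_def dest: inj_onD)
  define \<tau> where "\<tau> = \<sigma>(c := \<sigma> d1, d1 := \<sigma> c, d2 := \<sigma> c)"
  define \<omega> :: "nat \<times> nat \<Rightarrow> real" where "\<omega> = (\<lambda>(i, j).
    if j = c then (if i = \<sigma> c then 3 else if i = \<sigma> d1 then 2 else 0)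
    else if j = d1 \<or> j = d2 then (if i = \<sigma> c \<or> i = \<sigma> d1 then 2 else 0)
    else if i = \<sigma> j then 2 else 0)"
  have \<omega>0: "\<omega> x \<ge> 0" for x by (simp add: \<omega>_def split: prod.split)
  have \<tau>1: "placement \<tau> B1 = placement (\<sigma>(c := \<sigma> d1, d1 := \<sigma> c)) B1"
    unfolding placement_def by (intro image_cong) (use inB in \<open>auto simp: \<tau>_def\<close>)
  have \<tau>2: "placement \<tau> B2 = placement (\<sigma>(c := \<sigma> d2, d2 := \<sigma> c)) B2"
    unfolding placement_def by (intro image_cong) (use inB neq sd in \<open>auto simp: \<tau>_def\<close>)
  note best1 = swap_second_best[of B1 m _ c d1 \<sigma> \<omega>, OF fin1 _ c(1) inB(1) neq(2) sc, folded \<tau>1]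
  note best2 = swap_second_best[of B2 m _ c d2 \<sigma> \<omega>, OF fin2 _ c(2) inB(3) neq(3) sc[folded sd(1)], folded \<tau>2]
  have w1: "weight \<omega> (sqfree_monom (placement \<sigma> B1)) = 2 * m + 1" "weight \<omega> (sqfree_monom (placement \<tau> B1)) = 2 * m"
    by (rule best1[OF \<sigma>1]; use inB neq in \<open>auto simp: \<omega>_def\<close>)+
  have w2: "weight \<omega> (sqfree_monom (placement \<sigma> B2)) = 2 * m + 1" "weight \<omega> (sqfree_monom (placement \<tau> B2)) = 2 * m"
    by (rule best2[OF \<sigma>2]; use inB neq sd in \<open>auto simp: \<omega>_def\<close>)+
  have top1: "F = placement \<sigma> B1 \<or> F = placement \<tau> B1"
    if F: "matching {1..m} B1 F" "2 * m \<le> weight \<omega> (sqfree_monom F)" for F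
  proof -
    obtain \<phi> where \<phi>: "bij_betw \<phi> B1 {1..m}" "F = placement \<phi> B1" using F(1) unfolding matching_iff_placement by blast
    show ?thesis unfolding \<phi>(2)
      by (rule best1(3)[OF \<phi>(1)]; use inB neq F \<phi> in \<open>auto simp: \<omega>_def\<close>)
  qed
  have top2: "F = placement \<sigma> B2 \<or> F = placement \<tau> B2"
    if F: "matching {1..m} B2 F" "2 * m \<le> weight \<omega> (sqfree_monom F)" for F
  proof -
    obtain \<phi> where \<phi>: "bij_betw \<phi> B2 {1..m}" "F = placement \<phi> B2" using F(1) unfolding matching_iff_placement by blast
    show ?thesis unfolding \<phi>(2)
      by (rule best2(3)[OF \<phi>(1)]; use inB neq sd F \<phi> in \<open>auto simp: \<omega>_def\<close>)
  qed
  have m1: "matching {1..m} B1 (placement \<sigma> B1)" "matching {1..m} B2 (placement \<sigma> B2)"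
    using \<sigma>1 \<sigma>2 by (auto simp: matching_iff_placement)
  have "bij_betw (\<sigma> \<circ> transpose c d1) B1 {1..m}"
    using c inB by (intro bij_betw_trans[OF _ \<sigma>1] bij_betw_transpose_iff) simp
  moreover have "placement \<tau> B1 = placement (\<sigma> \<circ> transpose c d1) B1"
    unfolding placement_def by (intro image_cong) (use inB in \<open>auto simp: \<tau>_def transpose_def\<close>)
  ultimately have m2: "matching {1..m} B1 (placement \<tau> B1)" by (auto simp: matching_iff_placement)
  define f1 f2 :: "(nat \<times> nat, 'k) mpoly" where "f1 = minor m B1" and "f2 = minor m B2"
  define S1 S2 where "S1 = sqfree_monom (placement \<sigma> D2)" and "S2 = sqfree_monom (placement \<sigma> D1)"
  define c1 c2 where "c1 = Poly_Mapping.lookup f1 (sqfree_monom (placement \<sigma> B1))"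
    and "c2 = Poly_Mapping.lookup f2 (sqfree_monom (placement \<sigma> B2))"
  have c0: "c1 \<noteq> 0" "c2 \<noteq> 0"
    using keys_minor(2)[OF fin1 m1(1), where 'k='k] keys_minor(2)[OF fin2 m1(2), where 'k='k] by (auto simp: c1_def c2_def f1_def f2_def)
  have wS: "weight \<omega> S1 = 2 * card D1" "weight \<omega> S2 = 2 * card D1"
  proof -
    have wt: "weight \<omega> (sqfree_monom (placement \<sigma> D)) = 2 * card D" if D: "finite D" "c \<notin> D" for D
    proof -
      have "weight \<omega> (sqfree_monom (placement \<sigma> D)) = (\<Sum>j\<in>D. \<omega> (\<sigma> j, j))"
        using D(1) by (simp add: weight_sqfree_monom) (simp add: placement_def sum.reindex inj_on_def)
      also have "\<dots> = (\<Sum>j\<in>D. 2)" using D(2) sd by (intro sum.cong) (auto simp: \<omega>_def)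
      finally show ?thesis by simp
    qed
    show "weight \<omega> S1 = 2 * card D1" "weight \<omega> S2 = 2 * card D1"
      unfolding S1_def S2_def using finD c cardD by (auto simp: wt D1_def D2_def)
  qed
  have union: "S1 + sqfree_monom (placement \<psi> B1) = sqfree_monom (placement \<sigma> D2 \<union> placement \<psi> B1)"
    "S2 + sqfree_monom (placement \<psi> B2) = sqfree_monom (placement \<sigma> D1 \<union> placement \<psi> B2)" for \<psi>
    unfolding S1_def S2_def
    by (subst sqfree_monom_union; use fin1 fin2 finD in \<open>auto simp: D1_def D2_def\<close>)+
  have common: "S1 + sqfree_monom (placement \<sigma> B1) = S2 + sqfree_monom (placement \<sigma> B2)"
    unfolding union by (rule arg_cong[where f=sqfree_monom]) (auto simp: D1_def D2_def)
  \<comment> \<open>The S-polynomial of the two minors; the common leading term cancels.\<close>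
  define g where "g = Poly_Mapping.single S1 c2 * f1 - Poly_Mapping.single S2 c1 * f2"
  have keys1: "\<exists>F. matching {1..m} B1 F \<and> u = S1 + sqfree_monom F" if "u \<in> Poly_Mapping.keys (Poly_Mapping.single S1 c2 * f1)" for u
    using that by (auto simp: keys_single_times[OF c0(2)] f1_def keys_minor(1)[OF fin1])
  have keys2: "\<exists>F. matching {1..m} B2 F \<and> u = S2 + sqfree_monom F" if "u \<in> Poly_Mapping.keys (Poly_Mapping.single S2 c1 * f2)" for u
    using that by (auto simp: keys_single_times[OF c0(1)] f2_def keys_minor(1)[OF fin2])
  have cancel: "S1 + sqfree_monom (placement \<sigma> B1) \<notin> Poly_Mapping.keys g"
  proof -
    have "Poly_Mapping.lookup (Poly_Mapping.single S2 c1 * f2) (S1 + sqfree_monom (placement \<sigma> B1)) = c1 * c2"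
      unfolding common lookup_single_times c2_def ..
    moreover have "Poly_Mapping.lookup (Poly_Mapping.single S1 c2 * f1) (S1 + sqfree_monom (placement \<sigma> B1)) = c2 * c1"
      unfolding lookup_single_times c1_def ..
    ultimately show ?thesis by (simp add: in_keys_iff g_def lookup_minus)
  qed
  have key: "S1 + sqfree_monom (placement \<tau> B1) \<in> Poly_Mapping.keys g"
  proof -
    have "S1 + sqfree_monom (placement \<tau> B1) \<notin> Poly_Mapping.keys (Poly_Mapping.single S2 c1 * f2)"
    proof
      assume "S1 + sqfree_monom (placement \<tau> B1) \<in> Poly_Mapping.keys (Poly_Mapping.single S2 c1 * f2)"
      then obtain F where "S1 + sqfree_monom (placement \<tau> B1) = S2 + sqfree_monom F" using keys2 by blast
      then have "Poly_Mapping.lookup (S1 + sqfree_monom (placement \<tau> B1)) (\<sigma> d1, d1) \<ge> Poly_Mapping.lookup S2 (\<sigma> d1, d1)"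
        by (simp add: lookup_add)
      then have "(\<sigma> d1, d1) \<in> placement \<sigma> D2 \<union> placement \<tau> B1"
        using finD fin1 de1(1) by (auto simp: S1_def S2_def lookup_add lookup_sqfree_monom split: if_splits)
      then show False using inB sc neq by (auto simp: D2_def \<tau>_def)
    qed
    then have "Poly_Mapping.lookup g (S1 + sqfree_monom (placement \<tau> B1)) = c2 * Poly_Mapping.lookup f1 (sqfree_monom (placement \<tau> B1))"
      by (simp add: g_def lookup_minus lookup_single_times in_keys_iff)
    then show ?thesis
      using c0 keys_minor(2)[OF fin1 m2, where 'k='k] by (auto simp: in_keys_iff f1_def)
  qed
  have gJ: "g \<in> J_ideal m n \<Delta>"
  proof -
    note J = genideal_poly_ring[OF J_ideal_facts(1)[OF \<Delta>, where 'k='k], folded J_ideal_def]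
    have "\<sigma> j \<in> {1..m} \<and> j \<in> {1..n}" if "j \<in> B1 \<union> B2" for j
      using that \<sigma>1 \<sigma>2 pure(1)[OF B(1)] pure(1)[OF B(2)] by (auto simp: bij_betw_def)
    then have S: "S1 \<in> monoms (gen_vars m n)" "S2 \<in> monoms (gen_vars m n)"
      using finD by (auto simp: S1_def S2_def monoms_def gen_vars_def D1_def D2_def)
    show ?thesis unfolding g_def
      by (intro J(6) J(5)) (use S B J(1) in \<open>auto simp: carrier_poly_ring f1_def f2_def minors_def\<close>)
  qed
  have "g \<noteq> 0" using key by auto
  obtain u B' F where u: "u \<in> Poly_Mapping.keys g"
    "\<And>s. s \<in> Poly_Mapping.keys g \<Longrightarrow> weight \<omega> s \<le> weight \<omega> u" and B': "B' \<in> \<Delta>" and F: "matching {1..m} B' F" "F \<subseteq> Poly_Mapping.keys u"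
    "\<And>G. matching {1..m} B' G \<Longrightarrow> weight \<omega> (sqfree_monom G) \<le> weight \<omega> (sqfree_monom F)"
    by (rule universal_groebner_weight[where \<omega> = \<omega>, OF ugb \<Delta> \<omega>0 gJ \<open>g \<noteq> 0\<close>]) (rule that)
  have wu: "2 * m + 2 * card D1 \<le> weight \<omega> u"
    using u(2)[OF key] by (simp add: weight_add wS w1)
  have "u \<in> Poly_Mapping.keys (Poly_Mapping.single S1 c2 * f1) \<or> u \<in> Poly_Mapping.keys (Poly_Mapping.single S2 c1 * f2)"
    using u(1) unfolding g_def in_keys_iff lookup_minus by force
  then have "u = S1 + sqfree_monom (placement \<tau> B1) \<or> u = S2 + sqfree_monom (placement \<tau> B2)"
  proof
    assume "u \<in> Poly_Mapping.keys (Poly_Mapping.single S1 c2 * f1)"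
    then obtain G where G: "matching {1..m} B1 G" "u = S1 + sqfree_monom G" using keys1 by blast
    have "2 * m \<le> weight \<omega> (sqfree_monom G)" using wu by (simp add: G(2) weight_add wS)
    moreover have "G \<noteq> placement \<sigma> B1" using u(1) cancel unfolding G(2) by blast
    ultimately show ?thesis using top1[OF G(1)] G(2) by blast
  next
    assume "u \<in> Poly_Mapping.keys (Poly_Mapping.single S2 c1 * f2)"
    then obtain G where G: "matching {1..m} B2 G" "u = S2 + sqfree_monom G" using keys2 by blast
    have "2 * m \<le> weight \<omega> (sqfree_monom G)" using wu by (simp add: G(2) weight_add wS)
    moreover have "G \<noteq> placement \<sigma> B2" using u(1) cancel unfolding G(2) common by blast
    ultimately show ?thesis using top2[OF G(1)] G(2) by blast
  qed
  then have obstruct: "B' \<subseteq> B1 \<union> B2 \<and> B' \<noteq> B1 \<and> B' \<noteq> B2 \<and> \<not> (e1 \<in> B' \<and> e2 \<in> B')"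
  proof
    assume "u = S1 + sqfree_monom (placement \<tau> B1)"
    then have F': "F \<subseteq> placement \<sigma> D2 \<union> placement \<tau> B1" using F(2) finD fin1 by (simp add: union)
    note ob = swapped_placement_obstruction[OF F(1) F' c de2(1) _ _ _ inB(2) de2(3)]
    have "B' \<noteq> B1"
    proof
      assume B'1: "B' = B1"
      have "F = placement \<tau> B1" by (rule ob(4)[OF _ _ _ _ B'1]; use neq de1(3) sd in \<open>auto simp: \<tau>_def D2_def\<close>)
      then show False using F(3)[of "placement \<sigma> B1"] m1(1) w1 by (simp add: B'1)
    qed
    moreover have "B' \<subseteq> B1 \<union> D2" "B' \<noteq> B2" "\<not> (e1 \<in> B' \<and> e2 \<in> B')"
      by (rule ob; use neq sd de1 in \<open>auto simp: \<tau>_def D2_def\<close>)+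
    ultimately show ?thesis by (auto simp: D2_def)
  next
    assume "u = S2 + sqfree_monom (placement \<tau> B2)"
    then have F': "F \<subseteq> placement \<sigma> D1 \<union> placement \<tau> B2" using F(2) finD fin2 by (simp add: union)
    note ob = swapped_placement_obstruction[OF F(1) F' c(2,1) de1(1) _ _ _ inB(4) de1(2)]
    have "B' \<noteq> B2"
    proof
      assume B'2: "B' = B2"
      have "F = placement \<tau> B2" by (rule ob(4)[OF _ _ _ _ B'2]; use neq de1(3) sd in \<open>auto simp: \<tau>_def D1_def\<close>)
      then show False using F(3)[of "placement \<sigma> B2"] m1(2) w2 by (simp add: B'2)
    qed
    moreover have "B' \<subseteq> B2 \<union> D1" "B' \<noteq> B1" "\<not> (e2 \<in> B' \<and> e1 \<in> B')"
      by (rule ob; use neq sd de1 in \<open>auto simp: \<tau>_def D1_def\<close>)+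
    ultimately show ?thesis by (auto simp: D1_def)
  qed
  show thesis
    by (rule that[OF B']) (use obstruct de1 de2 in \<open>auto simp: D1_def D2_def\<close>)
qed

section \<open>From intersecting edges to cliques\<close>

text \<open>
  The \<open>(m - 1)\<close>-subsets of \<open>T\<close> are connected by exchanges of one vertex, and the closure of \<open>\<Delta>\<close> for
  edges that differ in one vertex carries \<open>insert z A \<in> \<Delta>\<close> along each exchange.
\<close>

lemma clique_insert:
  assumes adj: "\<And>B1 B2 B. B1 \<in> \<Delta> \<Longrightarrow> B2 \<in> \<Delta> \<Longrightarrow> card (B1 \<union> B2) = Suc m \<Longrightarrow> B \<subseteq> B1 \<union> B2 \<Longrightarrow> card B = m \<Longrightarrow> B \<in> \<Delta>"
    and T: "finite T" "clique m T \<subseteq> \<Delta>" and A: "A \<subseteq> T" "Suc (card A) = m" and z: "z \<notin> T" "insert z A \<in> \<Delta>"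
  shows "clique m (insert z T) \<subseteq> \<Delta>"
proof -
  have ins: "insert z A' \<in> \<Delta>" if "A' \<subseteq> T" "Suc (card A') = m" for A'
    using that
  proof (induction "card (A' - A)" arbitrary: A')
    case 0
    have "finite A'" using "0.prems"(1) T(1) finite_subset by blast
    then have "A' \<subseteq> A" using "0.hyps" by simp
    then have "A' = A" using A "0.prems"(2) T(1) by (metis Suc_inject card_subset_eq finite_subset)
    then show ?case using z(2) by simp
  next
    case (Suc k)
    have fin: "finite A" "finite A'" using A(1) Suc.prems(1) T(1) finite_subset by blast+
    obtain e where e: "e \<in> A'" "e \<notin> A" using Suc.hyps(2) by (metis Diff_iff card.empty ex_in_conv nat.distinct(1))
    have "\<not> A \<subseteq> A'" using fin A(2) Suc.prems(2) e by (metis Suc_inject card_subset_eq)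
    then obtain d where d: "d \<in> A" "d \<notin> A'" by blast
    define A'' where "A'' = insert d (A' - {e})"
    have "card (A' - {e}) = card A' - 1" using fin e by simp
    moreover have "card A' > 0" using fin e by (auto simp: card_gt_0_iff)
    ultimately have A'': "A'' \<subseteq> T" "Suc (card A'') = m" "finite A''"
      using fin d e A(1) Suc.prems by (auto simp: A''_def card_insert_if)
    have "A' - A = insert e (A'' - A)" using d e by (auto simp: A''_def)
    moreover have "e \<notin> A'' - A" using d e by (auto simp: A''_def)
    ultimately have "k = card (A'' - A)" using Suc.hyps(2) A''(3) by simp
    from Suc.hyps(1)[OF this A''(1,2)] have "insert z A'' \<in> \<Delta>" .
    moreover have "insert d A' \<in> \<Delta>" using T(2) d A(1) Suc.prems fin by (auto simp: clique_def)
    moreover have eq: "insert z A'' \<union> insert d A' = insert z (insert d A')" using e by (auto simp: A''_def)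
    moreover have "z \<notin> insert d A'" using z(1) d A(1) Suc.prems by auto
    then have "card (insert z (insert d A')) = Suc m" using fin d Suc.prems by simp
    moreover have "card (insert z A') = m" using fin z(1) Suc.prems by (auto simp: card_insert_if)
    ultimately show ?case using adj[of "insert z A''" "insert d A'" "insert z A'"] by auto
  qed
  show ?thesis
  proof
    fix B assume "B \<in> clique m (insert z T)"
    then have B: "B \<subseteq> insert z T" "card B = m" by (auto simp: clique_def)
    have finB: "finite B" using B(1) T(1) finite_subset by blast
    show "B \<in> \<Delta>"
    proof (cases "z \<in> B")
      case True
      then have "Suc (card (B - {z})) = m" using B finB by (metis card_Suc_Diff1)
      then have "insert z (B - {z}) \<in> \<Delta>" using B by (intro ins) auto
      then show ?thesis using True by (simp add: insert_absorb)
    next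
      case False
      then show ?thesis using B T(2) by (auto simp: clique_def)
    qed
  qed
qed

text \<open>
  Induction on the size of \<open>B1 - B2\<close>. The third edge misses a vertex of the symmetric difference, so
  it is closer to \<open>B1\<close> or to \<open>B2\<close> than these are to each other, and the induction hypothesis yields a
  clique larger than one of them. Exchanging one vertex inside that clique brings the two edges
  closer together, and the hypothesis applies once more, leaving out a single vertex \<open>z\<close>.
\<close>

lemma union_is_clique:
  assumes pure: "\<And>B. B \<in> \<Delta> \<Longrightarrow> finite B \<and> card B = m"
    and adj: "\<And>B1 B2 B. B1 \<in> \<Delta> \<Longrightarrow> B2 \<in> \<Delta> \<Longrightarrow> card (B1 \<union> B2) = Suc m \<Longrightarrow> B \<subseteq> B1 \<union> B2 \<Longrightarrow> card B = m \<Longrightarrow> B \<in> \<Delta>"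
    and new: "\<And>B1 B2. B1 \<in> \<Delta> \<Longrightarrow> B2 \<in> \<Delta> \<Longrightarrow> B1 \<inter> B2 \<noteq> {} \<Longrightarrow> card (B1 - B2) \<ge> 2 \<Longrightarrow>
      \<exists>B \<in> \<Delta>. B \<subseteq> B1 \<union> B2 \<and> B \<noteq> B1 \<and> B \<noteq> B2 \<and> \<not> (B1 - B2) \<union> (B2 - B1) \<subseteq> B"
    and B: "B1 \<in> \<Delta>" "B2 \<in> \<Delta>" "B1 \<inter> B2 \<noteq> {}"
  shows "clique m (B1 \<union> B2) \<subseteq> \<Delta>"
  using B
proof (induction "card (B1 - B2)" arbitrary: B1 B2 rule: less_induct)
  case less
  have card_sym: "card (A - B) = card (B - A)" if "A \<in> \<Delta>" "B \<in> \<Delta>" for A B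
    using pure[OF that(1)] pure[OF that(2)] by (simp add: card_Diff_subset_Int Int_commute)
  have card_Un: "card (A \<union> B) = m + card (A - B)" if "A \<in> \<Delta>" "B \<in> \<Delta>" for A B
  proof -
    have "card (A - B \<union> B) = card (A - B) + card B"
      using pure[OF that(1)] pure[OF that(2)] by (intro card_Un_disjoint) auto
    then show ?thesis using pure[OF that(2)] by simp
  qed
  consider "card (B1 - B2) = 0" | "card (B1 - B2) = 1" | "card (B1 - B2) \<ge> 2" by linarith
  then show ?case
  proof cases
    case 1
    then have "B1 - B2 = {}" using pure[OF less.prems(1)] by simp
    moreover have "B2 - B1 = {}" using 1 card_sym[OF less.prems(1,2)] pure[OF less.prems(2)] by simp
    ultimately have "B1 = B2" by blast
    moreover have "B = B2" if "B \<subseteq> B2" "card B = m" for B using that pure[OF less.prems(2)] card_subset_eq by metis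
    ultimately show ?thesis using less.prems by (auto simp: clique_def)
  next
    case 2
    then have "card (B1 \<union> B2) = Suc m" using card_Un less.prems by simp
    then show ?thesis using adj[OF less.prems(1,2)] by (auto simp: clique_def)
  next
    case 3
    \<comment> \<open>Stated for either order of the two edges, since the third edge may be closer to either of them.\<close>
    have main: "clique m (A \<union> A') \<subseteq> \<Delta>"
      if A: "A \<in> \<Delta>" "A' \<in> \<Delta>" "A \<inter> A' \<noteq> {}" "card (A - A') = card (B1 - B2)"
        and B: "B \<in> \<Delta>" "B \<subseteq> A \<union> A'" "B \<noteq> A" and x: "x \<in> A' - A" "x \<notin> B" for A A' B x
    proof -
      have fin: "finite A" "finite A'" "finite B" "card A = m" "card A' = m" "card B = m" using pure A B by auto
      have "B - A \<subset> A' - A" using B(2) x by auto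
      then have "card (B - A) < card (A' - A)" using fin by (intro psubset_card_mono) auto
      then have less1: "card (A - B) < card (B1 - B2)" using card_sym A B by simp
      have "A \<inter> B \<noteq> {}"
      proof
        assume "A \<inter> B = {}"
        then have "A - B = A" "A - A' \<subseteq> A" by auto
        then show False using less1 A(4) card_mono[OF fin(1), of "A - A'"] by auto
      qed
      from less.hyps[OF less1 A(1) B(1) this] have cl1: "clique m (A \<union> B) \<subseteq> \<Delta>" .
      have "\<not> B \<subseteq> A" using B(3) fin card_subset_eq by metis
      then obtain y where y: "y \<in> B" "y \<notin> A" by blast
      then have "y \<in> A'" using B(2) by auto
      have "A - A' \<noteq> {}" using 3 A(4) by (metis card.empty not_numeral_le_zero)
      then obtain z where z: "z \<in> A" "z \<notin> A'" by blast
      define A1 where "A1 = insert y (A - {z})"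
      have "card A > 0" using fin z by (auto simp: card_gt_0_iff)
      then have "card A1 = m" using fin y z by (simp add: A1_def card_insert_if)
      then have A1: "A1 \<in> \<Delta>" using cl1 y by (auto simp: A1_def clique_def)
      have "A1 - A' \<subset> A - A'" using \<open>y \<in> A'\<close> z by (auto simp: A1_def)
      then have less2: "card (A1 - A') < card (B1 - B2)" unfolding A(4)[symmetric] using fin by (intro psubset_card_mono) auto
      have "A1 \<inter> A' \<noteq> {}" using \<open>y \<in> A'\<close> by (auto simp: A1_def)
      from less.hyps[OF less2 A1 A(2) this] have cl2: "clique m (A1 \<union> A') \<subseteq> \<Delta>" .
      have "clique m (insert z (A1 \<union> A')) \<subseteq> \<Delta>"
      proof (rule clique_insert[where A = "A - {z}", OF _ _ cl2])
        show "B \<in> \<Delta>" if "B1 \<in> \<Delta>" "B2 \<in> \<Delta>" "card (B1 \<union> B2) = Suc m" "B \<subseteq> B1 \<union> B2" "card B = m"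
          for B1 B2 B by (rule adj[OF that])
        show "finite (A1 \<union> A')" using fin by (simp add: A1_def)
        show "A - {z} \<subseteq> A1 \<union> A'" by (auto simp: A1_def)
        show "Suc (card (A - {z})) = m" using fin z card_Suc_Diff1 by metis
        show "z \<notin> A1 \<union> A'" using y z by (auto simp: A1_def)
        show "insert z (A - {z}) \<in> \<Delta>" using A(1) z by (simp add: insert_absorb)
      qed
      moreover have "A \<union> A' \<subseteq> insert z (A1 \<union> A')" by (auto simp: A1_def)
      ultimately show ?thesis by (auto simp: clique_def)
    qed
    obtain B x where B: "B \<in> \<Delta>" "B \<subseteq> B1 \<union> B2" "B \<noteq> B1" "B \<noteq> B2" "x \<in> (B1 - B2) \<union> (B2 - B1)" "x \<notin> B"
      using new[OF less.prems 3] by blast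
    then consider "x \<in> B2 - B1" | "x \<in> B1 - B2" by blast
    then show ?thesis
    proof cases
      case 1
      show ?thesis by (rule main[OF less.prems refl B(1,2,3) 1 B(6)])
    next
      case 2
      have "clique m (B2 \<union> B1) \<subseteq> \<Delta>"
        by (rule main[OF less.prems(2,1) _ _ B(1) _ B(4) 2 B(6)])
          (use less.prems card_sym B(2) in auto)
      then show ?thesis by (simp add: Un_commute)
    qed
  qed
qed

text \<open>
  The vertex sets are the maximal cliques. Two cliques \<open>T1\<close>, \<open>T2\<close> with a common vertex \<open>c\<close> merge: an
  \<open>m\<close>-subset of the union that lies in neither is covered by an edge in \<open>T1\<close> and an edge in \<open>T2\<close>
  that both contain \<open>c\<close>.
\<close>

lemma disjoint_union_of_cliquesI:
  assumes m: "m > 0" and \<Delta>: "pure_hypergraph m n \<Delta>"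
    and un: "\<And>B1 B2. B1 \<in> \<Delta> \<Longrightarrow> B2 \<in> \<Delta> \<Longrightarrow> B1 \<inter> B2 \<noteq> {} \<Longrightarrow> clique m (B1 \<union> B2) \<subseteq> \<Delta>"
  shows "disjoint_union_of_cliques m n \<Delta>"
proof -
  define \<C> where "\<C> = {T. T \<subseteq> {1..n} \<and> m \<le> card T \<and> clique m T \<subseteq> \<Delta>}"
  define \<T> where "\<T> = {T \<in> \<C>. \<forall>T' \<in> \<C>. T \<subseteq> T' \<longrightarrow> T = T'}"
  have finC: "finite T" if "T \<in> \<C>" for T using that finite_subset by (auto simp: \<C>_def)
  \<comment> \<open>Edges inside a clique can be enlarged to contain \<open>c\<close> whenever there is room.\<close>
  have merge: "T1 \<union> T2 \<in> \<C>" if T: "T1 \<in> \<C>" "T2 \<in> \<C>" "c \<in> T1" "c \<in> T2" for T1 T2 c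
  proof -
    have extend: "\<exists>B'. c \<in> B' \<and> B \<inter> T \<subseteq> B' \<and> B' \<in> \<Delta>"
      if T: "T \<in> \<C>" "c \<in> T" "card (B \<inter> T) < m" "finite B" for B T
    proof -
      have "card (insert c (B \<inter> T)) \<le> m" using T by (simp add: card_insert_if)
      then obtain B' where "insert c (B \<inter> T) \<subseteq> B'" "B' \<subseteq> T" "card B' = m"
        using exists_subset_between[of "insert c (B \<inter> T)" m T] T finC[OF T(1)] by (auto simp: \<C>_def)
      then show ?thesis using T(1) by (auto simp: \<C>_def clique_def)
    qed
    have "B \<in> \<Delta>" if B: "B \<subseteq> T1 \<union> T2" "card B = m" for B
    proof -
      have finB: "finite B" using B m by (metis card.infinite less_numeral_extra(3))
      have "T \<in> \<C> \<Longrightarrow> card (B \<inter> T) \<ge> m \<Longrightarrow> B \<in> \<Delta>" for T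
      proof -
        assume "T \<in> \<C>" "card (B \<inter> T) \<ge> m"
        then have "B \<inter> T = B" using B(2) finB by (metis Int_lower1 card_mono card_subset_eq le_antisym)
        then show "B \<in> \<Delta>" using \<open>T \<in> \<C>\<close> B(2) by (auto simp: \<C>_def clique_def)
      qed
      moreover have "B \<in> \<Delta>" if less: "card (B \<inter> T1) < m" "card (B \<inter> T2) < m"
      proof -
        obtain B1 B2 where "c \<in> B1" "B \<inter> T1 \<subseteq> B1" "B1 \<in> \<Delta>" "c \<in> B2" "B \<inter> T2 \<subseteq> B2" "B2 \<in> \<Delta>"
          using extend[OF T(1,3) less(1) finB] extend[OF T(2,4) less(2) finB] by blast
        then show ?thesis using un[of B1 B2] B by (auto simp: clique_def)
      qed
      ultimately show ?thesis using T(1,2) by (meson not_le)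
    qed
    moreover have "m \<le> card (T1 \<union> T2)"
      using T(1) card_mono[of "T1 \<union> T2" T1] finC[OF T(1)] finC[OF T(2)] by (auto simp: \<C>_def)
    ultimately show ?thesis using T by (auto simp: \<C>_def clique_def)
  qed
  have "disjoint \<T>"
  proof (rule disjointI)
    fix T1 T2 assume T: "T1 \<in> \<T>" "T2 \<in> \<T>" "T1 \<noteq> T2"
    show "T1 \<inter> T2 = {}"
    proof (rule ccontr)
      assume "T1 \<inter> T2 \<noteq> {}"
      then obtain c where c: "c \<in> T1" "c \<in> T2" by blast
      have "T1 \<in> \<C>" "T2 \<in> \<C>" using T(1,2) by (simp_all add: \<T>_def)
      from merge[OF this c] have "T1 \<union> T2 \<in> \<C>" .
      then have "T1 = T1 \<union> T2" "T2 = T1 \<union> T2"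
        using T(1,2) Un_upper1[of T1 T2] Un_upper2[of T2 T1] unfolding \<T>_def mem_Collect_eq by metis+
      then show False using T(3) by metis
    qed
  qed
  moreover have "\<Delta> = (\<Union>T \<in> \<T>. clique m T)"
  proof
    show "(\<Union>T \<in> \<T>. clique m T) \<subseteq> \<Delta>" by (auto simp: \<T>_def \<C>_def)
    show "\<Delta> \<subseteq> (\<Union>T \<in> \<T>. clique m T)"
    proof
      fix B assume B: "B \<in> \<Delta>"
      then have B': "B \<subseteq> {1..n}" "card B = m" using \<Delta> by (auto simp: pure_hypergraph_def)
      have "C = B" if "C \<subseteq> B" "card C = m" for C
        using that B' by (intro card_subset_eq) (auto intro: finite_subset)
      then have "clique m B \<subseteq> \<Delta>" using B by (auto simp: clique_def)
      then have "B \<in> \<C>" using B' by (simp add: \<C>_def)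
      moreover have "\<C> \<subseteq> Pow {1..n}" by (auto simp: \<C>_def)
      then have "finite \<C>" by (rule finite_subset) simp
      ultimately obtain T where T: "T \<in> \<C>" "B \<subseteq> T" "\<forall>T' \<in> \<C>. T \<subseteq> T' \<longrightarrow> T = T'"
        using finite_has_maximal2[of \<C> B] by blast
      then have "T \<in> \<T>" "B \<in> clique m T" using B' by (auto simp: \<T>_def clique_def)
      then show "B \<in> (\<Union>T \<in> \<T>. clique m T)" by blast
    qed
  qed
  moreover have "\<forall>T \<in> \<T>. T \<subseteq> {1..n}" by (auto simp: \<T>_def \<C>_def)
  ultimately show ?thesis unfolding disjoint_union_of_cliques_def by blast
qed

section \<open>The characterisation\<close>

theorem mainTheorem5:
  fixes m n :: nat and \<Delta> :: "nat set set"
  assumes "2 < m" and "m \<le> n" and "pure_hypergraph m n \<Delta>"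
  shows "universal_groebner_basis (gen_vars m n)
           (minors m \<Delta> :: (nat \<times> nat, 'k::field) mpoly set) (J_ideal m n \<Delta>)
         \<longleftrightarrow> disjoint_union_of_cliques m n \<Delta>"
proof
  assume ugb: "universal_groebner_basis (gen_vars m n)
    (minors m \<Delta> :: (nat \<times> nat, 'k) mpoly set) (J_ideal m n \<Delta>)"
  have pure: "finite B \<and> card B = m" if "B \<in> \<Delta>" for B
    using that assms(3) by (auto simp: pure_hypergraph_def intro: finite_subset)
  have new: "\<exists>B \<in> \<Delta>. B \<subseteq> B1 \<union> B2 \<and> B \<noteq> B1 \<and> B \<noteq> B2 \<and> \<not> (B1 - B2) \<union> (B2 - B1) \<subseteq> B"
    if "B1 \<in> \<Delta>" "B2 \<in> \<Delta>" "B1 \<inter> B2 \<noteq> {}" "card (B1 - B2) \<ge> 2" for B1 B2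
    by (rule third_edge[OF ugb assms(3) that]) blast
  have m: "m \<ge> 1" "m > 0" using assms(1) by simp_all
  show "disjoint_union_of_cliques m n \<Delta>"
  proof (rule disjoint_union_of_cliquesI[OF m(2) assms(3)])
    fix B1 B2 assume B: "B1 \<in> \<Delta>" "B2 \<in> \<Delta>" "B1 \<inter> B2 \<noteq> {}"
    show "clique m (B1 \<union> B2) \<subseteq> \<Delta>"
      by (rule union_is_clique[OF pure adjacent_edges[OF ugb assms(3) m(1)] new B])
  qed
next
  assume "disjoint_union_of_cliques m n \<Delta>"
  then obtain \<T> where \<T>: "\<forall>T \<in> \<T>. T \<subseteq> {1..n}" "disjoint \<T>" "\<Delta> = (\<Union>T \<in> \<T>. clique m T)"
    unfolding disjoint_union_of_cliques_def by blast
  have "2 \<le> m" using assms(1) by simp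
  from clique_minors_groebner_basis[OF this assms(3) _ \<T>(2,3)] \<T>(1)
  show "universal_groebner_basis (gen_vars m n)
    (minors m \<Delta> :: (nat \<times> nat, 'k) mpoly set) (J_ideal m n \<Delta>)"
    unfolding universal_groebner_basis_def by blast
qed

end
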